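(* Let $k\geq 3$ and $n\geq 110k^{2}$ be integers, and let $G$ be a simple graph of order $n$. If $G$ contains no cycle $C_{2k+1}$ of length $2k+1$ as a subgraph, then $q(G)<q(S_{n,k})$, unless $G=S_{n,k}$ (i.e. $G$ is isomorphic to $S_{n,k}$).
   Context: For a simple graph $G$, the signless Laplacian is $Q(G)=D(G)+A(G)$, where $D(G)$ is the diagonal matrix of vertex degrees and $A(G)$ the adjacency matrix; the $Q$-index $q(G)$ is the largest eigenvalue of $Q(G)$. For $n\geq k$, $S_{n,k}=K_k\vee\overline{K}_{n-k}$ is the graph obtained by joining each vertex of a complete graph on $k$ vertices to each vertex of an independent set of $n-k$ vertices (and $K_k$ is complete). *)

theory Defs
  imports
    "Graph_Theory.Graph_Theory"
    "Jordan_Normal_Form.Spectral_Radius"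
begin

text \<open>
  Simple graphs are the locale \<^locale>\<open>pair_graph\<close>: a finite vertex set together with a symmetric,
  irreflexive set of arcs, so that every edge \<open>uv\<close> is represented by the two arcs \<open>(u, v)\<close>
  and \<open>(v, u)\<close>.
\<close>

section \<open>The graph \<open>S\<^sub>n\<^sub>,\<^sub>k\<close>\<close>

definition complete_on :: "'a set \<Rightarrow> 'a pair_pre_digraph" where
  "complete_on V = \<lparr> pverts = V, parcs = {(u, v). u \<in> V \<and> v \<in> V \<and> u \<noteq> v} \<rparr>"

definition graph_complement :: "'a pair_pre_digraph \<Rightarrow> 'a pair_pre_digraph" where
  "graph_complement G =
     \<lparr> pverts = pverts G,
       parcs = {(u, v). u \<in> pverts G \<and> v \<in> pverts G \<and> u \<noteq> v \<and> (u, v) \<notin> parcs G} \<rparr>"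

text \<open>Only meaningful when the vertex sets of the two graphs are disjoint.\<close>

definition graph_join ::
  "'a pair_pre_digraph \<Rightarrow> 'a pair_pre_digraph \<Rightarrow> 'a pair_pre_digraph" where
  "graph_join G H =
     \<lparr> pverts = pverts G \<union> pverts H,
       parcs = parcs G \<union> parcs H \<union> pverts G \<times> pverts H \<union> pverts H \<times> pverts G \<rparr>"

definition S_graph :: "nat \<Rightarrow> nat \<Rightarrow> nat pair_pre_digraph" where
  "S_graph n k = graph_join (complete_on {0..<k}) (graph_complement (complete_on {k..<n}))"

lemma pverts_S_graph: "k \<le> n \<Longrightarrow> pverts (S_graph n k) = {0..<n}"
  by (auto simp: S_graph_def graph_join_def complete_on_def graph_complement_def)

lemma parcs_S_graph:
  "k \<le> n \<Longrightarrow> parcs (S_graph n k) = {(u, v). u < n \<and> v < n \<and> u \<noteq> v \<and> (u < k \<or> v < k)}"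
  by (auto simp: S_graph_def graph_join_def complete_on_def graph_complement_def)

lemma pair_graph_S_graph:
  assumes "k \<le> n"
  shows "pair_graph (S_graph n k)"
proof unfold_locales
  have "parcs (S_graph n k) \<subseteq> {0..<n} \<times> {0..<n}"
    using assms by (auto simp: parcs_S_graph)
  then show "finite (parcs (S_graph n k))"
    by (rule finite_subset) simp
qed (use assms in \<open>auto simp: pverts_S_graph parcs_S_graph symmetric_def sym_def\<close>)

section \<open>Cycles and isomorphism\<close>

text \<open>
  A cycle is a closed walk without repeated vertices, given as the list of its arcs. The degenerate
  cycles \<open>u, v, u\<close>, which traverse one edge back and forth, have length 2; for \<open>l \<ge> 3\<close> the
  predicate says that \<open>C\<^sub>l\<close> is a subgraph of \<open>G\<close>.
\<close>

definition contains_cycle :: "'a pair_pre_digraph \<Rightarrow> nat \<Rightarrow> bool" where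
  "contains_cycle G l \<longleftrightarrow> (\<exists>p. pre_digraph.cycle (with_proj G) p \<and> length p = l)"

lemma digraph_iso_with_proj_iff:
  assumes "pair_graph G" "pair_graph H"
  shows "digraph_iso (with_proj G) (with_proj H) \<longleftrightarrow>
    (\<exists>f. bij_betw f (pverts G) (pverts H) \<and>
         (\<forall>u\<in>pverts G. \<forall>v\<in>pverts G. (u, v) \<in> parcs G \<longleftrightarrow> (f u, f v) \<in> parcs H))"
    (is "?L \<longleftrightarrow> ?R")
proof
  interpret G: pair_graph G by fact
  interpret H: pair_graph H by fact
  {
    assume ?L
    then obtain h where h: "pre_digraph.digraph_isomorphism (with_proj G) h"
      and eq: "with_proj H = app_iso h (with_proj G)"
      by (auto simp: digraph_iso_def)
    define f where "f = iso_verts h"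
    have inj: "inj_on f (pverts G)"
      using h by (simp add: pre_digraph.digraph_isomorphism_def f_def)
    have verts: "pverts H = f ` pverts G"
      using arg_cong[OF eq, of verts] by (simp add: f_def)
    have arcs: "parcs H = iso_arcs h ` parcs G"
      using arg_cong[OF eq, of arcs] by simp
    have tl: "iso_tail h = fst" and hd: "iso_head h = snd"
      using arg_cong[OF eq, of tail] arg_cong[OF eq, of head] by simp_all
    have arc: "iso_arcs h e = (f (fst e), f (snd e))" if "e \<in> parcs G" for e
      using h that unfolding pre_digraph.digraph_isomorphism_def
      by (auto simp: tl hd f_def prod_eq_iff)
    have arcs': "parcs H = (\<lambda>e. (f (fst e), f (snd e))) ` parcs G"
      unfolding arcs by (rule image_cong) (auto simp: arc)
    have "(u, v) \<in> parcs G \<longleftrightarrow> (f u, f v) \<in> parcs H"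
      if uv: "u \<in> pverts G" "v \<in> pverts G" for u v
    proof
      assume "(u, v) \<in> parcs G"
      then show "(f u, f v) \<in> parcs H"
        unfolding arcs' by (force intro: image_eqI[where x = "(u, v)"])
    next
      assume "(f u, f v) \<in> parcs H"
      then obtain a b where ab: "(a, b) \<in> parcs G" "f u = f a" "f v = f b"
        unfolding arcs' by auto
      moreover have "a \<in> pverts G" "b \<in> pverts G"
        using ab(1) G.wellformed' by auto
      ultimately show "(u, v) \<in> parcs G"
        using inj uv by (metis inj_onD)
    qed
    then show ?R
      using inj verts by (auto simp: bij_betw_def)
  }
  {
    assume ?R
    then obtain f where bij: "bij_betw f (pverts G) (pverts H)"
      and iff: "\<And>u v. u \<in> pverts G \<Longrightarrow> v \<in> pverts G \<Longrightarrow>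
        (u, v) \<in> parcs G \<longleftrightarrow> (f u, f v) \<in> parcs H"
      by blast
    have inj: "inj_on f (pverts G)" and img: "pverts H = f ` pverts G"
      using bij by (auto simp: bij_betw_def)
    define h where "h = \<lparr> iso_verts = f, iso_arcs = (\<lambda>e. (f (fst e), f (snd e))),
      iso_head = snd, iso_tail = fst \<rparr>"
    have "parcs H = iso_arcs h ` parcs G"
    proof (intro equalityI subsetI)
      fix e assume e: "e \<in> parcs H"
      then have "fst e \<in> f ` pverts G" "snd e \<in> f ` pverts G"
        using H.arc_fst_in_verts H.arc_snd_in_verts img by auto
      then obtain u v where uv: "u \<in> pverts G" "v \<in> pverts G" "e = (f u, f v)"
        by (metis imageE prod.collapse)
      then have "(u, v) \<in> parcs G"
        using iff e by simp
      then show "e \<in> iso_arcs h ` parcs G"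
        using uv by (force simp: h_def)
    next
      fix e assume "e \<in> iso_arcs h ` parcs G"
      then obtain u v where "(u, v) \<in> parcs G" "e = (f u, f v)"
        by (auto simp: h_def)
      then show "e \<in> parcs H"
        using iff G.in_arcsD1 G.in_arcsD2 by metis
    qed
    then have "with_proj H = app_iso h (with_proj G)"
      using img by (simp add: app_iso_def with_proj_def h_def)
    moreover have "inj_on (iso_arcs h) (parcs G)"
    proof (rule inj_onI)
      fix d e assume "d \<in> parcs G" "e \<in> parcs G" "iso_arcs h d = iso_arcs h e"
      then show "d = e"
        using inj G.arc_fst_in_verts G.arc_snd_in_verts
        by (simp add: h_def inj_on_eq_iff prod_eq_iff)
    qed
    then have "pre_digraph.digraph_isomorphism (with_proj G) h"
      unfolding pre_digraph.digraph_isomorphism_def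
      using inj G.wf_digraph by (auto simp: h_def)
    ultimately show ?L
      by (auto simp: digraph_iso_def)
  }
qed

section \<open>The signless Laplacian and the \<open>Q\<close>-index\<close>

text \<open>
  Matrices are indexed by \<open>{0..<n}\<close>, so the vertices have to be enumerated. The choice is immaterial
  for the spectrum: see \<open>eigenvalue_signless_laplacian_iff\<close> below.
\<close>

definition vertex_enum :: "'a pair_pre_digraph \<Rightarrow> nat \<Rightarrow> 'a" where
  "vertex_enum G = (SOME f. bij_betw f {0..<card (pverts G)} (pverts G))"

definition degree_matrix :: "'a pair_pre_digraph \<Rightarrow> real mat" where
  "degree_matrix G =
     mat_diag (card (pverts G)) (\<lambda>i. real (out_degree (with_proj G) (vertex_enum G i)))"

definition adjacency_matrix :: "'a pair_pre_digraph \<Rightarrow> real mat" where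
  "adjacency_matrix G = mat (card (pverts G)) (card (pverts G))
     (\<lambda>(i, j). if (vertex_enum G i, vertex_enum G j) \<in> parcs G then 1 else 0)"

definition signless_laplacian :: "'a pair_pre_digraph \<Rightarrow> real mat" where
  "signless_laplacian G = degree_matrix G + adjacency_matrix G"

definition Q_index :: "'a pair_pre_digraph \<Rightarrow> real" where
  "Q_index G = Max (spectrum (signless_laplacian G))"

lemma bij_betw_vertex_enum:
  assumes "finite (pverts G)"
  shows "bij_betw (vertex_enum G) {0..<card (pverts G)} (pverts G)"
  unfolding vertex_enum_def using ex_bij_betw_nat_finite[OF assms] by (rule someI_ex)

lemma signless_laplacian_carrier:
  "signless_laplacian G \<in> carrier_mat (card (pverts G)) (card (pverts G))"
  by (simp add: signless_laplacian_def adjacency_matrix_def degree_matrix_def)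

lemma finite_spectrum_signless_laplacian: "finite (spectrum (signless_laplacian G))"
  using card_finite_spectrum(1)[OF signless_laplacian_carrier] .

lemma eigenvalue_signless_laplacian_iff:
  assumes "pair_graph G"
  shows "eigenvalue (signless_laplacian G) c \<longleftrightarrow>
    (\<exists>x. (\<exists>v\<in>pverts G. x v \<noteq> 0) \<and>
         (\<forall>v\<in>pverts G. real (out_degree (with_proj G) v) * x v + (\<Sum>u | (v, u) \<in> parcs G. x u) = c * x v))"
    (is "_ \<longleftrightarrow> (\<exists>x. ?nz x \<and> ?ev x)")
proof -
  interpret G: pair_graph G by fact
  let ?n = "card (pverts G)" and ?e = "vertex_enum G" and ?Q = "signless_laplacian G"
  note bij = bij_betw_vertex_enum[OF G.pair_finite_verts]
  have img: "?e ` {0..<?n} = pverts G" and inj: "inj_on ?e {0..<?n}"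
    using bij by (auto simp: bij_betw_def)
  have row: "(?Q *\<^sub>v w) $ i = real (out_degree (with_proj G) (?e i)) * x (?e i)
      + (\<Sum>u | (?e i, u) \<in> parcs G. x u)"
    if w: "w \<in> carrier_vec ?n" and i: "i < ?n" and wx: "\<And>j. j < ?n \<Longrightarrow> w $ j = x (?e j)"
    for w x i
  proof -
    let ?d = "real (out_degree (with_proj G) (?e i))"
    have "(?Q *\<^sub>v w) $ i = (\<Sum>j = 0..<?n. ?Q $$ (i, j) * w $ j)"
      using w i by (simp add: signless_laplacian_def adjacency_matrix_def degree_matrix_def
          scalar_prod_def)
    also have "\<dots> = (\<Sum>j = 0..<?n. (if j = i then ?d * x (?e j) else 0)
        + (if (?e i, ?e j) \<in> parcs G then x (?e j) else 0))"
      using i by (intro sum.cong)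
        (auto simp: signless_laplacian_def adjacency_matrix_def degree_matrix_def mat_diag_def
          wx algebra_simps)
    also have "\<dots> = ?d * x (?e i) + (\<Sum>j = 0..<?n. if (?e i, ?e j) \<in> parcs G then x (?e j) else 0)"
      using i by (simp add: sum.distrib)
    also have "(\<Sum>j = 0..<?n. if (?e i, ?e j) \<in> parcs G then x (?e j) else 0)
        = (\<Sum>u\<in>pverts G. if (?e i, u) \<in> parcs G then x u else 0)"
      by (rule sum.reindex_bij_betw[OF bij])
    also have "\<dots> = (\<Sum>u | (?e i, u) \<in> parcs G. x u)"
      using G.pair_finite_verts G.wellformed'
      by (intro sum.mono_neutral_cong_right) auto
    finally show ?thesis .
  qed
  show ?thesis
  proof
    assume "eigenvalue ?Q c"
    then obtain w where w: "w \<in> carrier_vec ?n" "w \<noteq> 0\<^sub>v ?n" "?Q *\<^sub>v w = c \<cdot>\<^sub>v w"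
      using signless_laplacian_carrier[of G] by (auto simp: eigenvalue_def eigenvector_def)
    define x where "x v = w $ (the_inv_into {0..<?n} ?e v)" for v
    have wx: "w $ j = x (?e j)" if "j < ?n" for j
      using the_inv_into_f_f[OF inj, of j] that by (simp add: x_def)
    obtain j where "j < ?n" "w $ j \<noteq> 0"
      using w(1,2) by (metis carrier_vecD eq_vecI index_zero_vec)
    then have "?nz x"
      using wx img by force
    moreover have "?ev x"
    proof
      fix v assume "v \<in> pverts G"
      then obtain i where i: "i < ?n" "v = ?e i"
        using img by force
      show "real (out_degree (with_proj G) v) * x v + (\<Sum>u | (v, u) \<in> parcs G. x u) = c * x v"
        using row[OF w(1) i(1) wx] w i wx by simp
    qed
    ultimately show "\<exists>x. ?nz x \<and> ?ev x" by blast
  next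
    assume "\<exists>x. ?nz x \<and> ?ev x"
    then obtain x where nz: "?nz x" and ev: "?ev x" by blast
    define w where "w = vec ?n (\<lambda>j. x (?e j))"
    have wc: "w \<in> carrier_vec ?n" and wx: "\<And>j. j < ?n \<Longrightarrow> w $ j = x (?e j)"
      by (simp_all add: w_def)
    obtain i where "i < ?n" "x (?e i) \<noteq> 0"
      using nz img by force
    then have "w \<noteq> 0\<^sub>v ?n"
      using wx by force
    moreover have "?Q *\<^sub>v w = c \<cdot>\<^sub>v w"
    proof (rule eq_vecI)
      fix i assume "i < dim_vec (c \<cdot>\<^sub>v w)"
      then have i: "i < ?n" using wc by simp
      then have "?e i \<in> pverts G" using img by force
      then show "(?Q *\<^sub>v w) $ i = (c \<cdot>\<^sub>v w) $ i"
        using row[OF wc i wx] ev wc wx i by simp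
    qed (use wc signless_laplacian_carrier[of G] in auto)
    ultimately show "eigenvalue ?Q c"
      using wc signless_laplacian_carrier[of G] by (auto simp: eigenvalue_def eigenvector_def)
  qed
qed

end

theory Submission
  imports Defs
begin

text \<open>
  Let \<open>q\<close> be an eigenvalue of \<open>Q(G)\<close> with \<open>q \<ge> \<mu> = q(S\<^sub>n\<^sub>,\<^sub>k)\<close>, let \<open>x\<close> be the vector of
  absolute values of an eigenvector and let \<open>w\<close> maximize \<open>y v = x v / d v\<close>, normalized to \<open>y w = 1\<close>.
  The eigenvalue equation at \<open>w\<close> gives \<open>q d(w) \<le> d(w)\<^sup>2 + \<Sum> d(v) y(v)\<close>, summed over the set
  \<open>A\<close> of neighbours of \<open>w\<close>. As \<open>G[A]\<close> contains no path on \<open>2k\<close> vertices, the Erdos-Gallai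
  theorem bounds the right-hand side by \<open>d(w) (n + 2k - 2)\<close>, which exceeds \<open>d(w) \<mu>\<close> by at most
  \<open>2k(k - 1) d(w) / n\<close>. Every inequality used is thus nearly tight. If \<open>w\<close> were not adjacent to
  all other vertices, then \<open>A\<close> would be almost completely joined to the remaining vertices and would
  have about \<open>(k - 1) d(w)\<close> edges, which forces a \<open>2k\<close>-path with both ends in \<open>A\<close>. So \<open>w\<close> is
  dominating, and \<open>\<Sum> d(v) (1 - y(v)) \<le> 2k(k - 1)\<close>.

  Feeding this into the eigenvalue equations at the other vertices shows that vertices of degree at
  least \<open>n/2\<close> have degree at least \<open>n - 5k\<close> and that few edges avoid them, so there are at least
  \<open>k\<close> of them. Fix a set \<open>L\<^sub>0\<close> of \<open>k\<close> such vertices containing \<open>w\<close>. An edge outside \<open>L\<^sub>0\<close> with an end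
  adjacent to a vertex of \<open>L\<^sub>0 - {w}\<close> closes a cycle of length \<open>2k + 1\<close>. Hence the positive
  eigenvector \<open>z\<close> of \<open>S\<^sub>n\<^sub>,\<^sub>k\<close> placed on \<open>L\<^sub>0\<close> satisfies \<open>Q(G) z \<le> \<mu> z\<close>; pairing with \<open>x\<close>
  forces equality on the support of \<open>x\<close>, which makes \<open>G\<close> a copy of \<open>S\<^sub>n\<^sub>,\<^sub>k\<close>.
\<close>

section \<open>Paths and the Erdos-Gallai theorem\<close>

text \<open>Paths are vertex lists: \<open>length\<close> counts vertices, not edges, and the empty
  list is a path.\<close>

definition path_in :: "('a \<Rightarrow> 'a \<Rightarrow> bool) \<Rightarrow> 'a set \<Rightarrow> 'a list \<Rightarrow> bool" where
  "path_in E S xs \<longleftrightarrow> set xs \<subseteq> S \<and> distinct xs \<and> successively E xs"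

text \<open>\<open>v\<close> need not lie in \<open>S\<close>, so the same count also measures edges
  from a vertex into a disjoint set.\<close>

definition deg_in :: "('a \<Rightarrow> 'a \<Rightarrow> bool) \<Rightarrow> 'a set \<Rightarrow> 'a \<Rightarrow> nat" where
  "deg_in E S v = card {u \<in> S. E v u}"

lemma path_in_take: "path_in E S xs \<Longrightarrow> path_in E S (take i xs)"
  unfolding path_in_def
  by (metis append_take_drop_id distinct_append dual_order.trans set_take_subset successively_append_iff)

lemma path_in_drop: "path_in E S xs \<Longrightarrow> path_in E S (drop i xs)"
  unfolding path_in_def
  by (metis append_take_drop_id distinct_append dual_order.trans set_drop_subset successively_append_iff)

lemma path_in_mono: "path_in E S xs \<Longrightarrow> S \<subseteq> T \<Longrightarrow> path_in E T xs"
  unfolding path_in_def by blast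

lemma deg_in_le_card: "finite S \<Longrightarrow> irreflp E \<Longrightarrow> v \<in> S \<Longrightarrow> deg_in E S v \<le> card S - 1"
proof -
  assume *: "finite S" "irreflp E" "v \<in> S"
  then have "{u \<in> S. E v u} \<subseteq> S - {v}" by (auto dest: irreflpD)
  from card_mono[OF _ this] * show ?thesis by (simp add: deg_in_def)
qed

lemma deg_in_Un:
  assumes "finite S" "finite T" "S \<inter> T = {}"
  shows "deg_in E (S \<union> T) v = deg_in E S v + deg_in E T v"
proof -
  have "{u \<in> S \<union> T. E v u} = {u \<in> S. E v u} \<union> {u \<in> T. E v u}" by auto
  then show ?thesis
    unfolding deg_in_def using assms by (simp add: card_Un_disjoint disjoint_iff)
qed

lemma deg_in_le: "finite S \<Longrightarrow> deg_in E S v \<le> card S"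
  unfolding deg_in_def by (intro card_mono) auto

lemma card_nonadjacent: "finite S \<Longrightarrow> card {u \<in> S. \<not> E v u} = card S - deg_in E S v"
proof -
  assume "finite S"
  moreover have "{u \<in> S. \<not> E v u} = S - {u \<in> S. E v u}" by auto
  ultimately show ?thesis unfolding deg_in_def by (simp add: card_Diff_subset)
qed

lemma sum_deg_in_remove:
  assumes "finite S" "v \<in> S" "symp E" "irreflp E"
  shows "(\<Sum>u\<in>S. deg_in E S u) = (\<Sum>u\<in>S - {v}. deg_in E (S - {v}) u) + 2 * deg_in E S v"
proof -
  have "deg_in E S u = deg_in E (S - {v}) u + (if E v u then 1 else 0)" if "u \<in> S - {v}" for u
  proof (cases "E v u")
    case True
    then have "{x \<in> S. E u x} = insert v {x \<in> S - {v}. E u x}"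
      using assms by (auto dest: sympD)
    then show ?thesis using True assms(1) by (simp add: deg_in_def)
  next
    case False
    then have "{x \<in> S. E u x} = {x \<in> S - {v}. E u x}"
      using assms(3) by (auto dest: sympD)
    then show ?thesis using False by (simp add: deg_in_def)
  qed
  then have "(\<Sum>u\<in>S - {v}. deg_in E S u)
      = (\<Sum>u\<in>S - {v}. deg_in E (S - {v}) u) + (\<Sum>u\<in>S - {v}. if E v u then 1 else 0)"
    by (simp add: sum.distrib)
  also have "(\<Sum>u\<in>S - {v}. if E v u then 1 else 0) = deg_in E S v"
    using assms by (subst sum.If_cases) (auto simp: deg_in_def intro!: arg_cong[of _ _ card] dest: irreflpD)
  finally show ?thesis
    using assms by (simp add: sum.remove[of S v])
qed

text \<open>Maximality puts all neighbours of both ends on the path. By pigeonhole, some two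
  consecutive vertices are such that the later is adjacent to the first end and the earlier to the
  last end. Cutting between them and reversing the second piece closes the path.\<close>

lemma longest_path_is_cycle:
  assumes E: "symp E" "irreflp E" and fin: "finite S"
    and xs: "path_in E S xs" "xs \<noteq> []"
    and max: "\<And>ys. path_in E S ys \<Longrightarrow> length ys \<le> length xs"
    and deg: "length xs \<le> deg_in E S (hd xs) + deg_in E S (last xs)"
  obtains c where "path_in E S c" "set c = set xs" "c \<noteq> []" "length c = length xs" "E (last c) (hd c)"
proof -
  let ?p = "length xs"
  have d: "distinct xs" and succ: "successively E xs" and sub: "set xs \<subseteq> S"
    using xs by (auto simp: path_in_def)
  have hd_on: "u \<in> set xs" if "u \<in> S" "E (hd xs) u" for u
  proof (rule ccontr)
    assume "u \<notin> set xs"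
    then have "path_in E S (u # xs)"
      using that xs E(1) by (auto simp: path_in_def successively_Cons dest: sympD)
    from max[OF this] show False by simp
  qed
  have last_on: "u \<in> set xs" if "u \<in> S" "E (last xs) u" for u
  proof (rule ccontr)
    assume "u \<notin> set xs"
    then have "path_in E S (xs @ [u])"
      using that xs by (auto simp: path_in_def successively_append_iff)
    from max[OF this] show False by simp
  qed
  define I where "I = {i. i < ?p - 1 \<and> E (hd xs) (xs ! Suc i)}"
  define J where "J = {i. i < ?p - 1 \<and> E (last xs) (xs ! i)}"
  have "{u \<in> S. E (hd xs) u} \<subseteq> (\<lambda>i. xs ! Suc i) ` I"
  proof
    fix u assume u: "u \<in> {u \<in> S. E (hd xs) u}"
    then obtain j where j: "j < ?p" "u = xs ! j"
      using hd_on by (metis (mono_tags, lifting) in_set_conv_nth mem_Collect_eq)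
    have "j \<noteq> 0" using u j E(2) xs(2) by (metis hd_conv_nth irreflpD mem_Collect_eq)
    then show "u \<in> (\<lambda>i. xs ! Suc i) ` I"
      using u j by (intro image_eqI[of _ _ "j - 1"]) (auto simp: I_def)
  qed
  then have cI: "deg_in E S (hd xs) \<le> card I"
    unfolding deg_in_def by (intro surj_card_le) (auto simp: I_def)
  have "{u \<in> S. E (last xs) u} \<subseteq> (\<lambda>i. xs ! i) ` J"
  proof
    fix u assume u: "u \<in> {u \<in> S. E (last xs) u}"
    then obtain j where j: "j < ?p" "u = xs ! j"
      using last_on by (metis (mono_tags, lifting) in_set_conv_nth mem_Collect_eq)
    have "j \<noteq> ?p - 1" using u j E(2) xs(2) by (metis last_conv_nth irreflpD mem_Collect_eq)
    then show "u \<in> (\<lambda>i. xs ! i) ` J"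
      using u j by (intro image_eqI[of _ _ j]) (auto simp: J_def)
  qed
  then have cJ: "deg_in E S (last xs) \<le> card J"
    unfolding deg_in_def by (intro surj_card_le) (auto simp: J_def)
  have "I \<inter> J \<noteq> {}"
  proof
    assume "I \<inter> J = {}"
    then have "card I + card J = card (I \<union> J)"
      by (intro card_Un_disjoint[symmetric]) (auto simp: I_def J_def)
    also have "\<dots> \<le> card {..<?p - 1}"
      by (intro card_mono) (auto simp: I_def J_def)
    finally show False using cI cJ deg xs(2) by (cases xs) auto
  qed
  then obtain i where i: "i < ?p - 1" "E (hd xs) (xs ! Suc i)" "E (last xs) (xs ! i)"
    by (auto simp: I_def J_def)
  define a where "a = take (Suc i) xs"
  define b where "b = drop (Suc i) xs"
  have ab: "xs = a @ b" "a \<noteq> []" "b \<noteq> []" using i xs(2) by (auto simp: a_def b_def)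
  have la: "last a = xs ! i"
    using i by (simp add: a_def take_Suc_conv_app_nth)
  have hb: "hd b = xs ! Suc i" using i by (simp add: b_def hd_drop_conv_nth)
  have sb: "successively (\<lambda>x y. E y x) b"
    using succ ab E(1) by (auto simp: successively_append_iff elim!: successively_mono dest: sympD)
  show thesis
  proof
    show "path_in E S (a @ rev b)"
      using d sub succ ab la hb sb i E(1)
      by (auto simp: path_in_def successively_append_iff hd_rev last_rev dest: sympD)
    show "set (a @ rev b) = set xs" using ab by auto
    show "a @ rev b \<noteq> []" using ab by simp
    show "length (a @ rev b) = length xs" by (simp add: ab)
    show "E (last (a @ rev b)) (hd (a @ rev b))"
      using ab hb i E(1) by (auto simp: last_rev dest: sympD)
  qed
qed

text \<open>Otherwise the cycle could be cut open at \<open>v\<close> and \<open>u\<close> put in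
  front, giving a longer path.\<close>

lemma longest_cycle_closed:
  assumes E: "symp E" and c: "path_in E S c" "E (last c) (hd c)"
    and max: "\<And>ys. path_in E S ys \<Longrightarrow> length ys \<le> length c"
    and "v \<in> set c" "u \<in> S" "E v u"
  shows "u \<in> set c"
proof (rule ccontr)
  assume u: "u \<notin> set c"
  obtain ys zs where c_eq: "c = ys @ v # zs" using \<open>v \<in> set c\<close> by (meson split_list)
  have "path_in E S (u # v # zs @ ys)"
    using c u assms(6,7) E unfolding c_eq
    by (cases "ys = []")
      (auto simp: path_in_def successively_append_iff successively_Cons dest: sympD split: if_splits)
  from max[OF this] show False by (simp add: c_eq)
qed

text \<open>Induction on the size of \<open>S\<close>. A vertex with at most
  \<open>(r - 2) / 2\<close> neighbours can be deleted. If there is none, a longest path closes into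
  a cycle on fewer than \<open>r\<close> vertices which no edge leaves, and this cycle is split
  off.\<close>

lemma erdos_gallai_path:
  fixes E :: "'a \<Rightarrow> 'a \<Rightarrow> bool"
  assumes E: "symp E" "irreflp E" and r: "r \<ge> 2"
  shows "finite S \<Longrightarrow> (\<And>xs. path_in E S xs \<Longrightarrow> length xs \<noteq> r) \<Longrightarrow>
    (\<Sum>v\<in>S. deg_in E S v) \<le> (r - 2) * card S"
proof (induction "card S" arbitrary: S rule: less_induct)
  case less
  note fin = \<open>finite S\<close>
  have IH: "(\<Sum>v\<in>T. deg_in E T v) \<le> (r - 2) * card T" if "T \<subset> S" for T
    using less.hyps[OF psubset_card_mono[OF fin that]] less.prems that
    by (meson finite_subset path_in_mono psubset_imp_subset)
  show ?case
  proof (cases "\<exists>v\<in>S. 2 * deg_in E S v \<le> r - 2")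
    case True
    then obtain v where v: "v \<in> S" "2 * deg_in E S v \<le> r - 2" by blast
    have "(\<Sum>u\<in>S. deg_in E S u) = (\<Sum>u\<in>S - {v}. deg_in E (S - {v}) u) + 2 * deg_in E S v"
      by (rule sum_deg_in_remove[OF fin v(1) E])
    also have "\<dots> \<le> (r - 2) * card (S - {v}) + (r - 2)"
      using IH[of "S - {v}"] v by (intro add_mono) auto
    also have "\<dots> = (r - 2) * card S"
      using card_Suc_Diff1[OF fin v(1)] by (metis add.commute mult_Suc_right)
    finally show ?thesis .
  next
    case False
    then have big: "r - 1 \<le> 2 * deg_in E S v" if "v \<in> S" for v
      using that r by force
    show ?thesis
    proof (cases "S = {}")
      case False
      \<comment> \<open>Only length exactly \<open>r\<close> is excluded, but a longer path has a
        prefix of that length.\<close>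
      have short: "length ys < r" if "path_in E S ys" for ys
        using less.prems(2)[OF path_in_take[OF that, of r]] by (simp add: min_def split: if_splits)
      obtain s where "s \<in> S" using False by blast
      then have "path_in E S [s]" by (simp add: path_in_def)
      then obtain xs where xs: "path_in E S xs"
        and max: "\<And>ys. path_in E S ys \<Longrightarrow> length ys \<le> length xs"
        using ex_has_greatest_nat[of "path_in E S" "[s]" length r] short by (meson less_imp_le)
      have ne: "xs \<noteq> []" using max[OF \<open>path_in E S [s]\<close>] by auto
      have mem: "hd xs \<in> S" "last xs \<in> S" using xs ne by (auto simp: path_in_def)
      have deg: "length xs \<le> deg_in E S (hd xs) + deg_in E S (last xs)"
        using big[OF mem(1)] big[OF mem(2)] short[OF xs] by linarith
      obtain c where c: "path_in E S c" "c \<noteq> []" "length c = length xs" "E (last c) (hd c)"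
        using longest_path_is_cycle[OF E fin xs ne max deg] by metis
      let ?C = "set c"
      have closed: "u \<in> ?C" if "v \<in> ?C" "u \<in> S" "E v u" for u v
        using longest_cycle_closed[OF E(1) c(1,4) _ that] max c(3) by simp
      have CS: "?C \<subseteq> S" and cardC: "card ?C = length c"
        using c(1) by (auto simp: path_in_def distinct_card)
      have "deg_in E S v = deg_in E ?C v" if "v \<in> ?C" for v
        unfolding deg_in_def using closed[OF that] CS by (intro arg_cong[of _ _ card]) auto
      moreover have "deg_in E ?C v \<le> r - 2" if "v \<in> ?C" for v
        using deg_in_le_card[of ?C E v] that E(2) short[OF c(1)] cardC by simp
      ultimately have "(\<Sum>v\<in>?C. deg_in E S v) \<le> (\<Sum>v\<in>?C. r - 2)"
        by (intro sum_mono) simp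
      then have 1: "(\<Sum>v\<in>?C. deg_in E S v) \<le> (r - 2) * card ?C"
        by (simp add: mult.commute)
      have "deg_in E S v = deg_in E (S - ?C) v" if "v \<in> S - ?C" for v
        unfolding deg_in_def using closed that E(1)
        by (intro arg_cong[of _ _ card]) (auto dest: sympD)
      then have "(\<Sum>v\<in>S - ?C. deg_in E S v) = (\<Sum>v\<in>S - ?C. deg_in E (S - ?C) v)"
        by simp
      also have "\<dots> \<le> (r - 2) * card (S - ?C)"
        using c(2) CS by (intro IH) (cases c, auto)
      finally have 2: "(\<Sum>v\<in>S - ?C. deg_in E S v) \<le> (r - 2) * card (S - ?C)" .
      have "(\<Sum>v\<in>S. deg_in E S v) = (\<Sum>v\<in>S - ?C. deg_in E S v) + (\<Sum>v\<in>?C. deg_in E S v)"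
        by (rule sum.subset_diff[OF CS fin])
      also have "\<dots> \<le> (r - 2) * (card (S - ?C) + card ?C)"
        using 1 2 by (simp add: distrib_left)
      also have "card (S - ?C) + card ?C = card S"
        using CS fin by (simp add: card_Diff_subset card_mono)
      finally show ?thesis .
    qed simp
  qed
qed

text \<open>Serves to build cycles of prescribed length: one fresh connector joins each two
  consecutive entries of \<open>ls\<close>, and \<open>F\<close> holds what the connectors must
  avoid. The last connector chosen must differ from \<open>F\<close> and from
  \<open>length ls - 2\<close> earlier connectors, whence the bound \<open>M + 2\<close>.\<close>

lemma zigzag_path:
  assumes E: "symp E"
    and link: "\<And>l l' X. l \<in> T \<Longrightarrow> l' \<in> T \<Longrightarrow> finite X \<Longrightarrow> card X \<le> M \<Longrightarrow> \<exists>b. b \<notin> X \<and> E l b \<and> E b l'"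
  shows "ls \<noteq> [] \<Longrightarrow> distinct ls \<Longrightarrow> set ls \<subseteq> T \<Longrightarrow> finite F \<Longrightarrow> set ls \<subseteq> F \<Longrightarrow>
    card F + length ls \<le> M + 2 \<Longrightarrow>
    \<exists>xs. distinct xs \<and> successively E xs \<and> xs \<noteq> [] \<and> hd xs = hd ls \<and> last xs = last ls \<and>
      length xs + 1 = 2 * length ls \<and> set xs \<inter> F = set ls"
proof (induction ls rule: induct_list012)
  case (2 l)
  then show ?case by (intro exI[of _ "[l]"]) auto
next
  case (3 l l' ls)
  obtain xs where xs: "distinct xs" "successively E xs" "xs \<noteq> []" "hd xs = l'"
    "last xs = last (l' # ls)" "length xs + 1 = 2 * length (l' # ls)" "set xs \<inter> F = set (l' # ls)"
    using "3.IH"(2) "3.prems" by auto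
  have "card (F \<union> set xs) = card F + card (set xs - F)"
    using "3.prems" by (metis Un_Diff_cancel card_Un_disjoint Diff_disjoint List.finite_set finite_Diff)
  also have "card (set xs - F) = card (set xs) - card (set (l' # ls))"
    using xs(7) by (metis Diff_Int_distrib2 List.finite_set card_Diff_subset_Int)
  also have "\<dots> = length ls"
    using xs(1,6) "3.prems"(2) distinct_card[of xs] distinct_card[of "l' # ls"] by simp
  finally have "card (F \<union> set xs) \<le> M" using "3.prems" by simp
  then obtain b where b: "b \<notin> F \<union> set xs" "E l b" "E b l'"
    using link[of l l' "F \<union> set xs"] "3.prems" by auto
  have "l \<notin> set xs" using xs(7) "3.prems" by auto
  then show ?case
    using xs b "3.prems"
    by (intro exI[of _ "l # b # xs"]) (auto simp: successively_Cons)
qed simp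

section \<open>The \<open>Q\<close>-index of \<open>S\<^sub>n\<^sub>,\<^sub>k\<close>\<close>

text \<open>
  The vector that is \<open>1\<close> on the clique and \<open>\<zeta>\<close> on the independent set is an eigenvector of
  \<open>Q(S\<^sub>n\<^sub>,\<^sub>k)\<close> for \<open>\<mu>\<close> if \<open>\<mu> \<zeta> = k (1 + \<zeta>)\<close> and \<open>\<mu> = n + k - 2 + (n - k) \<zeta>\<close>. Eliminating \<open>\<zeta>\<close>
  leaves a quadratic equation, whose larger root is taken here.
\<close>

definition S_mu :: "nat \<Rightarrow> nat \<Rightarrow> real" where
  "S_mu n k = (real n + 2 * real k - 2
     + sqrt ((real n + 2 * real k - 2)\<^sup>2 - 8 * real k * (real k - 1))) / 2"

lemma S_mu_props:
  assumes "k \<ge> 1" "n \<ge> 2 * k\<^sup>2"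
  shows "(S_mu n k)\<^sup>2 - (real n + 2 * real k - 2) * S_mu n k + 2 * real k * (real k - 1) = 0"
    and "S_mu n k \<ge> real n"
proof -
  let ?b = "real n + 2 * real k - 2"
  let ?c = "2 * real k * (real k - 1)"
  have n: "real n \<ge> 2 * (real k)\<^sup>2" using assms(2) by (metis of_nat_le_iff of_nat_mult of_nat_numeral of_nat_power)
  have k: "real k \<ge> 1" using assms(1) by simp
  have mu: "S_mu n k = (?b + sqrt (?b\<^sup>2 - 4 * ?c)) / 2"
    unfolding S_mu_def by (simp add: algebra_simps)
  \<comment> \<open>In this form the discriminant has square root at least
    \<open>n - 2k + 2\<close>, so the larger root of the quadratic is at least
    \<open>n\<close>.\<close>
  have eq: "?b\<^sup>2 - 4 * ?c = (real n - 2 * real k + 2)\<^sup>2 + 8 * (real k - 1) * (real n - real k)"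
    by (simp add: power2_eq_square algebra_simps)
  have "real k * 1 \<le> real k * real k" using k by (intro mult_left_mono) auto
  then have nk: "real n \<ge> 2 * real k" using n by (simp add: power2_eq_square)
  have "0 \<le> (real k - 1) * (real n - real k)" using k nk by (intro mult_nonneg_nonneg) auto
  then have disc: "?b\<^sup>2 - 4 * ?c \<ge> (real n - 2 * real k + 2)\<^sup>2"
    unfolding eq by (simp add: mult.assoc del: right_diff_distrib_numeral)
  then have nn: "?b\<^sup>2 - 4 * ?c \<ge> 0" by (meson order_trans zero_le_power2)
  have "sqrt (?b\<^sup>2 - 4 * ?c) \<ge> real n - 2 * real k + 2"
    using disc nk by (intro real_le_rsqrt) auto
  then show "S_mu n k \<ge> real n" unfolding mu by simp
  show "(S_mu n k)\<^sup>2 - ?b * S_mu n k + ?c = 0"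
    using real_sqrt_pow2[OF nn] unfolding mu by (simp add: power2_eq_square field_simps)
qed

lemma S_mu_equations:
  fixes n k :: nat
  assumes "k \<ge> 1" "n \<ge> 2 * k\<^sup>2"
  defines "\<zeta> \<equiv> real k / (S_mu n k - real k)"
  shows "0 < S_mu n k - real k"
    and "S_mu n k * \<zeta> = real k * (1 + \<zeta>)"
    and "S_mu n k = (real n - 1) + (real k - 1) + (real n - real k) * \<zeta>"
proof -
  let ?\<mu> = "S_mu n k"
  note mu = S_mu_props[OF assms(1,2)]
  have "k * 1 \<le> k * k" using assms(1) by (intro mult_left_mono) auto
  then have "n \<ge> 2 * k" using assms(2) unfolding power2_eq_square by linarith
  then show mk: "0 < ?\<mu> - real k" using mu(2) assms(1) by linarith
  have \<zeta>_mult: "\<zeta> * (?\<mu> - real k) = real k" using mk by (simp add: \<zeta>_def)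
  then show "?\<mu> * \<zeta> = real k * (1 + \<zeta>)" by (simp add: algebra_simps)
  \<comment> \<open>The quadratic equation, factored so that \<open>\<mu> - k\<close> cancels
    against the denominator of \<open>\<zeta>\<close>.\<close>
  have "(?\<mu> - real k) * (?\<mu> - real n - real k + 2) = real k * (real n - real k)"
    using mu(1) by (simp add: power2_eq_square algebra_simps)
  also have "\<dots> = \<zeta> * (?\<mu> - real k) * (real n - real k)" by (simp only: \<zeta>_mult)
  also have "\<dots> = (?\<mu> - real k) * (\<zeta> * (real n - real k))" by (simp only: mult_ac)
  finally have "?\<mu> - real n - real k + 2 = \<zeta> * (real n - real k)"
    using mk by (subst (asm) mult_left_cancel) auto
  then show "?\<mu> = (real n - 1) + (real k - 1) + (real n - real k) * \<zeta>" by (simp add: algebra_simps)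
qed

text \<open>Makes the maximum in \<open>Q_index\<close> meaningful. For a complex eigenvector with
  real part \<open>a\<close>, imaginary part \<open>b\<close> and eigenvalue \<open>c\<close>,
  symmetry equates the products of \<open>b\<close> with \<open>A a\<close> and of \<open>a\<close>
  with \<open>A b\<close>. This forces \<open>Im c = 0\<close>, so whichever of \<open>a\<close>,
  \<open>b\<close> is nonzero is a real eigenvector.\<close>

lemma symmetric_mat_eigenvalue:
  fixes A :: "real mat"
  assumes A: "A \<in> carrier_mat n n" and n: "n > 0"
    and sym: "\<And>i j. i < n \<Longrightarrow> j < n \<Longrightarrow> A $$ (i, j) = A $$ (j, i)"
  shows "\<exists>c. eigenvalue A c"
proof -
  let ?A = "map_mat complex_of_real A"
  have cA: "?A \<in> carrier_mat n n" using A by simp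
  obtain c where "eigenvalue ?A c"
    using spectrum_non_empty[OF cA n] by (auto simp: spectrum_def)
  then obtain v where v: "v \<in> carrier_vec n" "v \<noteq> 0\<^sub>v n" "?A *\<^sub>v v = c \<cdot>\<^sub>v v"
    using cA by (auto simp: eigenvalue_def eigenvector_def)
  define a where "a i = Re (v $ i)" for i
  define b where "b i = Im (v $ i)" for i
  have row: "(\<Sum>j = 0..<n. complex_of_real (A $$ (i, j)) * v $ j) = c * v $ i" if "i < n" for i
  proof -
    have "(?A *\<^sub>v v) $ i = (\<Sum>j = 0..<n. complex_of_real (A $$ (i, j)) * v $ j)"
      using that v(1) A by (simp add: scalar_prod_def)
    then show ?thesis using v that by simp
  qed
  have re: "(\<Sum>j = 0..<n. A $$ (i, j) * a j) = Re c * a i - Im c * b i" if "i < n" for i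
    using arg_cong[OF row[OF that], of Re] by (simp add: a_def b_def)
  have im: "(\<Sum>j = 0..<n. A $$ (i, j) * b j) = Re c * b i + Im c * a i" if "i < n" for i
    using arg_cong[OF row[OF that], of Im] by (simp add: a_def b_def)
  have "(\<Sum>i = 0..<n. b i * (\<Sum>j = 0..<n. A $$ (i, j) * a j))
      = (\<Sum>i = 0..<n. \<Sum>j = 0..<n. b i * (A $$ (i, j) * a j))"
    by (simp only: sum_distrib_left)
  also have "\<dots> = (\<Sum>j = 0..<n. \<Sum>i = 0..<n. b i * (A $$ (i, j) * a j))" by (rule sum.swap)
  also have "\<dots> = (\<Sum>j = 0..<n. \<Sum>i = 0..<n. a j * (A $$ (j, i) * b i))"
    using sym by (intro sum.cong refl) simp
  also have "\<dots> = (\<Sum>j = 0..<n. a j * (\<Sum>i = 0..<n. A $$ (j, i) * b i))"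
    by (simp only: sum_distrib_left)
  finally have "(\<Sum>i = 0..<n. b i * (Re c * a i - Im c * b i))
      = (\<Sum>j = 0..<n. a j * (Re c * b j + Im c * a j))"
    by (simp add: re im)
  then have "(\<Sum>i = 0..<n. a i * (Re c * b i + Im c * a i) - b i * (Re c * a i - Im c * b i)) = 0"
    by (simp add: sum_subtractf)
  also have "(\<Sum>i = 0..<n. a i * (Re c * b i + Im c * a i) - b i * (Re c * a i - Im c * b i))
      = Im c * (\<Sum>i = 0..<n. (a i)\<^sup>2 + (b i)\<^sup>2)"
    unfolding sum_distrib_left by (intro sum.cong) (auto simp: algebra_simps power2_eq_square)
  finally have prod0: "Im c * (\<Sum>i = 0..<n. (a i)\<^sup>2 + (b i)\<^sup>2) = 0" .
  obtain i where i: "i < n" "v $ i \<noteq> 0"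
    using v(1,2) by (metis carrier_vecD eq_vecI index_zero_vec)
  then have abi: "a i \<noteq> 0 \<or> b i \<noteq> 0" by (simp add: a_def b_def complex_eq_iff)
  have "(\<Sum>i = 0..<n. (a i)\<^sup>2 + (b i)\<^sup>2) \<noteq> 0"
  proof
    assume "(\<Sum>i = 0..<n. (a i)\<^sup>2 + (b i)\<^sup>2) = 0"
    then have "(a i)\<^sup>2 + (b i)\<^sup>2 = 0"
      using i(1) by (subst (asm) sum_nonneg_eq_0_iff) auto
    then show False using abi by (simp add: sum_power2_eq_zero_iff)
  qed
  with prod0 have Im0: "Im c = 0" by simp
  have ev: "eigenvalue A (Re c)"
    if f: "\<And>i. i < n \<Longrightarrow> (\<Sum>j = 0..<n. A $$ (i, j) * f j) = Re c * f i" "f i \<noteq> 0" for f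
  proof -
    have "A *\<^sub>v vec n f = Re c \<cdot>\<^sub>v vec n f"
      using A f(1) by (intro eq_vecI) (auto simp: scalar_prod_def)
    moreover have "vec n f \<noteq> 0\<^sub>v n"
      using i(1) f(2) by (metis index_vec index_zero_vec(1))
    ultimately show ?thesis
      using A unfolding eigenvalue_def eigenvector_def by (intro exI[of _ "vec n f"]) auto
  qed
  show ?thesis
    using abi ev[of a] ev[of b] re im Im0 by auto
qed

section \<open>The \<open>Q\<close>-index as an eigenvalue, and its lower bound for
  \<open>S_graph n k\<close>\<close>

lemma signless_laplacian_sym:
  assumes "pair_graph G" "i < card (pverts G)" "j < card (pverts G)"
  shows "signless_laplacian G $$ (i, j) = signless_laplacian G $$ (j, i)"
proof -
  interpret pair_graph G by fact
  have "(vertex_enum G i, vertex_enum G j) \<in> parcs G \<longleftrightarrow> (vertex_enum G j, vertex_enum G i) \<in> parcs G"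
    using pair_sym_arcs by (auto simp: symmetric_def sym_def)
  then show ?thesis
    using assms by (auto simp: signless_laplacian_def degree_matrix_def adjacency_matrix_def mat_diag_def)
qed

lemma Q_index_eigenvalue:
  assumes "pair_graph G" "pverts G \<noteq> {}"
  shows "eigenvalue (signless_laplacian G) (Q_index G)"
proof -
  interpret pair_graph G by fact
  have "card (pverts G) > 0" using assms(2) pair_finite_verts by (simp add: card_gt_0_iff)
  then have "spectrum (signless_laplacian G) \<noteq> {}"
    using symmetric_mat_eigenvalue[OF signless_laplacian_carrier[of G]] signless_laplacian_sym[OF assms(1)]
    by (auto simp: spectrum_def)
  then have "Q_index G \<in> spectrum (signless_laplacian G)"
    unfolding Q_index_def by (intro Max_in finite_spectrum_signless_laplacian)
  then show ?thesis by (simp add: spectrum_def)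
qed

lemma eigenvalue_le_Q_index: "eigenvalue (signless_laplacian G) c \<Longrightarrow> c \<le> Q_index G"
  unfolding Q_index_def
  by (intro Max_ge finite_spectrum_signless_laplacian) (simp add: spectrum_def)

lemma out_degree_with_proj: "out_degree (with_proj G) v = card {u. (v, u) \<in> parcs G}"
proof -
  have "out_arcs (with_proj G) v = Pair v ` {u. (v, u) \<in> parcs G}"
    by (auto simp: out_arcs_def)
  then show ?thesis
    by (simp add: out_degree_def card_image inj_on_def)
qed

text \<open>Replaces \<open>q(S_graph n k)\<close> by an explicit number: a counterexample
  \<open>G\<close> then has an eigenvalue of at least \<open>S_mu n k\<close>.\<close>

lemma S_mu_le_Q_index:
  assumes "k \<ge> 1" "n \<ge> 2 * k\<^sup>2"
  shows "S_mu n k \<le> Q_index (S_graph n k)"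
proof -
  define \<zeta> where "\<zeta> = real k / (S_mu n k - real k)"
  note mu = S_mu_equations[OF assms, folded \<zeta>_def]
  have "k \<le> k\<^sup>2" using assms(1) by (simp add: power2_eq_square)
  then have kn: "k \<le> n" using assms(2) by linarith
  define x where "x v = (if v < k then 1 else \<zeta>)" for v
  let ?G = "S_graph n k"
  have sum_x: "(\<Sum>u = 0..<n. x u) = real k + (real n - real k) * \<zeta>"
  proof -
    have "(\<Sum>u = 0..<n. x u) = (\<Sum>u = 0..<k. x u) + (\<Sum>u = k..<n. x u)"
      using kn by (simp add: sum.atLeastLessThan_concat)
    then show ?thesis using kn by (simp add: x_def of_nat_diff)
  qed
  have "eigenvalue (signless_laplacian ?G) (S_mu n k)"
    unfolding eigenvalue_signless_laplacian_iff[OF pair_graph_S_graph[OF kn]]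
  proof (intro exI[of _ x] conjI ballI)
    show "\<exists>v\<in>pverts ?G. x v \<noteq> 0"
      using assms(1) kn by (intro bexI[of _ 0]) (auto simp: x_def pverts_S_graph)
  next
    fix v assume "v \<in> pverts ?G"
    then have v: "v < n" using kn by (simp add: pverts_S_graph)
    show "real (out_degree (with_proj ?G) v) * x v + (\<Sum>u | (v, u) \<in> parcs ?G. x u) = S_mu n k * x v"
    proof (cases "v < k")
      case True
      then have nb: "{u. (v, u) \<in> parcs ?G} = {0..<n} - {v}"
        using v kn by (auto simp: parcs_S_graph)
      have "(\<Sum>u\<in>{0..<n} - {v}. x u) = (\<Sum>u = 0..<n. x u) - x v"
        using sum.remove[of "{0..<n}" v x] v by simp
      moreover have "x v = 1" using True by (simp add: x_def)
      ultimately show ?thesis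
        using mu(3) v by (simp add: out_degree_with_proj nb sum_x of_nat_diff)
    next
      case False
      then have nb: "{u. (v, u) \<in> parcs ?G} = {0..<k}"
        using v kn by (auto simp: parcs_S_graph)
      show ?thesis
        using mu(2) False by (simp add: out_degree_with_proj nb x_def algebra_simps)
    qed
  qed
  then show ?thesis by (rule eigenvalue_le_Q_index)
qed

section \<open>Nearly extremal graphs\<close>

locale finite_graph =
  fixes V :: "'a set" and E :: "'a \<Rightarrow> 'a \<Rightarrow> bool"
  assumes fin: "finite V" and symE: "symp E" and irrE: "irreflp E"
    and EV: "E u v \<Longrightarrow> u \<in> V"
begin

abbreviation nb :: "'a \<Rightarrow> 'a set" where "nb v \<equiv> {u. E v u}"
abbreviation d :: "'a \<Rightarrow> nat" where "d \<equiv> deg_in E V"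

lemma E_sym: "E u v \<Longrightarrow> E v u"
  using symE by (auto dest: sympD)

lemma E_irr [simp]: "\<not> E u u"
  using irrE by (auto dest: irreflpD)

lemma EV2: "E u v \<Longrightarrow> v \<in> V"
  using EV E_sym by blast

lemma nb_subset: "nb v \<subseteq> V" using EV2 by auto

lemma finite_nb [simp]: "finite (nb v)" using nb_subset fin finite_subset by blast

lemma card_nb: "card (nb v) = d v"
  unfolding deg_in_def using EV2 by (intro arg_cong[of _ _ card]) auto

end

text \<open>
  The eigenvector enters only through \<open>y v = \<bar>x v\<bar> / d v\<close>. Passing to absolute values weakens the
  eigenvalue equation to the inequality \<open>eig\<close>, so no Perron-Frobenius theory is needed.
\<close>

locale extremal_graph = finite_graph +
  fixes k n :: nat and q :: real and y :: "'a \<Rightarrow> real" and w :: 'a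
  assumes k3: "k \<ge> 3" and n_card: "card V = n" and n_ge: "n \<ge> 110 * k\<^sup>2"
    and no_cycle: "\<And>c. distinct c \<Longrightarrow> successively E c \<Longrightarrow> c \<noteq> [] \<Longrightarrow> E (last c) (hd c) \<Longrightarrow>
      length c \<noteq> 2 * k + 1"
    and q_ge: "q \<ge> S_mu n k"
    and y_nonneg: "\<And>v. v \<in> V \<Longrightarrow> 0 \<le> y v" and y_le: "\<And>v. v \<in> V \<Longrightarrow> y v \<le> 1"
    and w: "w \<in> V" "d w > 0" "y w = 1"
    and eig: "\<And>v. v \<in> V \<Longrightarrow>
      q * (d v * y v) \<le> (d v)\<^sup>2 * y v + (\<Sum>u\<in>nb v. d u * y u)"
begin

section \<open>Numerical estimates and the lower bound for \<open>q\<close>\<close>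

abbreviation A where "A \<equiv> nb w"
abbreviation B where "B \<equiv> V - insert w A"
text \<open>The roots of the quadratic for \<open>S_mu\<close> have sum \<open>n + 2k - 2\<close>
  and product \<open>2k(k - 1)\<close>. So \<open>S_mu\<close> falls short of that sum by the other
  root, which is at most \<open>eps\<close> because \<open>S_mu \<ge> n\<close>.\<close>

definition eps :: real where "eps = 2 * real k * (real k - 1) / real n"

lemma n_ge_real: "real n \<ge> 110 * (real k)\<^sup>2"
  using n_ge by (metis of_nat_le_iff of_nat_mult of_nat_numeral of_nat_power)

lemma k3_real: "real k \<ge> 3" using k3 by simp

lemma n_ge_k: "real n \<ge> 330 * real k"
proof -
  have "110 * (3 * real k) \<le> 110 * (real k * real k)" using k3_real by (intro mult_left_mono) auto
  then show ?thesis using n_ge_real by (simp add: power2_eq_square)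
qed

lemma n_ge_k_nat: "n \<ge> 330 * k" using n_ge_k by (simp flip: of_nat_le_iff)

lemma n_pos: "real n > 0" using n_ge_k k3_real by linarith

lemma mu_eq: "(S_mu n k)\<^sup>2 - (real n + 2 * real k - 2) * S_mu n k + 2 * real k * (real k - 1) = 0"
  and mu_ge: "S_mu n k \<ge> real n"
  using S_mu_props[of k n] k3 n_ge by auto

lemma eps_nonneg: "0 \<le> eps" unfolding eps_def using k3_real by simp

lemma eps_mult: "real n * eps = 2 * real k * (real k - 1)"
  unfolding eps_def using n_pos by simp

lemma eps_le: "eps \<le> 1 / 55"
proof -
  have "2 * real k * (real k - 1) \<le> 2 * (real k)\<^sup>2"
    by (simp add: power2_eq_square algebra_simps)
  also have "\<dots> \<le> real n / 55" using n_ge_real by simp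
  finally show ?thesis unfolding eps_def using n_pos by (simp add: field_simps)
qed

lemma q_lower: "q \<ge> real n + 2 * real k - 2 - eps"
proof -
  let ?m = "S_mu n k"
  have pos: "?m > 0" using mu_ge n_pos by linarith
  have "?m * (real n + 2 * real k - 2 - ?m) = 2 * real k * (real k - 1)"
    using mu_eq by (simp add: power2_eq_square algebra_simps)
  then have "real n + 2 * real k - 2 - ?m = 2 * real k * (real k - 1) / ?m"
    using pos by (simp add: field_simps)
  also have "\<dots> \<le> eps"
    unfolding eps_def using mu_ge n_pos k3_real by (intro divide_left_mono) auto
  finally show ?thesis using q_ge by linarith
qed

text \<open>Putting \<open>w\<close> in front closes a forbidden cycle. Only the ends must be
  adjacent to \<open>w\<close>, so paths running through \<open>B\<close> are covered.\<close>

lemma no_path_in_nbhd: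
  assumes "distinct xs" "successively E xs" "w \<notin> set xs" "E w (hd xs)" "E w (last xs)"
  shows "length xs \<noteq> 2 * k"
proof
  assume "length xs = 2 * k"
  then have "xs \<noteq> []" using k3 by auto
  then have "successively E (w # xs)" "distinct (w # xs)" "E (last (w # xs)) (hd (w # xs))"
    using assms E_sym by (auto simp: successively_Cons)
  then show False using no_cycle[of "w # xs"] \<open>length xs = 2 * k\<close> by simp
qed

section \<open>Counting edges around the neighbourhood of \<open>w\<close>\<close>

lemma w_notin_A: "w \<notin> A" by simp

lemma finB: "finite B" using fin by simp

lemma V_split: "V = insert w (A \<union> B)" using w nb_subset by auto

lemma cardA: "card A = d w" by (rule card_nb)

lemma card_split: "n = 1 + d w + card B"
proof -
  have "card V = Suc (card (A \<union> B))"
    using finB by (subst V_split, subst card_insert_disjoint) auto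
  also have "card (A \<union> B) = card A + card B" using finB by (intro card_Un_disjoint) auto
  finally show ?thesis using n_card cardA by simp
qed

lemma deg_split: "v \<in> A \<Longrightarrow> d v = 1 + deg_in E A v + deg_in E B v"
proof -
  assume v: "v \<in> A"
  have "d v = deg_in E ({w} \<union> (A \<union> B)) v" using V_split by simp
  also have "\<dots> = deg_in E {w} v + deg_in E (A \<union> B) v"
    using finB by (intro deg_in_Un) auto
  also have "deg_in E (A \<union> B) v = deg_in E A v + deg_in E B v"
    using finB by (intro deg_in_Un) auto
  also have "deg_in E {w} v = card {w}"
    unfolding deg_in_def using v E_sym by (intro arg_cong[of _ _ card]) auto
  finally show ?thesis by simp
qed

lemma edges_A: "(\<Sum>v\<in>A. deg_in E A v) \<le> (2 * k - 2) * d w"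
proof -
  have "length xs \<noteq> 2 * k" if xs: "path_in E A xs" for xs
  proof
    assume l: "length xs = 2 * k"
    then have "xs \<noteq> []" using k3 by auto
    then have "hd xs \<in> A" "last xs \<in> A"
      using xs hd_in_set last_in_set unfolding path_in_def by blast+
    moreover have "w \<notin> set xs" using xs w_notin_A unfolding path_in_def by blast
    ultimately show False using no_path_in_nbhd[of xs] xs l unfolding path_in_def by auto
  qed
  then show ?thesis
    using erdos_gallai_path[OF symE irrE, of "2 * k" A] k3 cardA by simp
qed

text \<open>The eigenvalue inequality at \<open>w\<close>, with \<open>d v\<close> split into its
  edges to \<open>w\<close>, \<open>A\<close> and \<open>B\<close>. The three terms are the losses
  from \<open>y v < 1\<close>, from the Erdos-Gallai bound in \<open>A\<close> and from missing
  edges between \<open>A\<close> and \<open>B\<close>. Without losses the right-hand side would be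
  \<open>d w * (n + 2k - 2)\<close>, and \<open>q\<close> is at most \<open>eps\<close> below
  \<open>n + 2k - 2\<close>.\<close>

lemma tightness:
  "(\<Sum>v\<in>A. d v * (1 - y v)) + ((2 * real k - 2) * d w - real (\<Sum>v\<in>A. deg_in E A v))
    + (\<Sum>v\<in>A. real (card {b \<in> B. \<not> E v b})) \<le> d w * eps"
proof -
  have miss: "real (card {b \<in> B. \<not> E v b}) = real (card B) - deg_in E B v" for v
    using deg_in_le[OF finB, of E v] by (simp only: card_nonadjacent[OF finB] of_nat_diff)
  have "q * d w \<le> (d w)\<^sup>2 + (\<Sum>v\<in>A. d v * y v)"
    using eig[OF w(1)] w(3) by simp
  moreover have "(\<Sum>v\<in>A. d v * (1 - y v)) = (\<Sum>v\<in>A. real (d v)) - (\<Sum>v\<in>A. d v * y v)"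
    by (simp add: right_diff_distrib sum_subtractf)
  moreover have "(\<Sum>v\<in>A. real (d v))
      = (\<Sum>v\<in>A. 1 + real (deg_in E A v) + real (deg_in E B v))"
    by (intro sum.cong refl) (simp add: deg_split)
  moreover have "\<dots> = d w + real (\<Sum>v\<in>A. deg_in E A v) + (\<Sum>v\<in>A. real (deg_in E B v))"
    by (simp add: sum.distrib cardA)
  moreover have "(\<Sum>v\<in>A. real (card {b \<in> B. \<not> E v b}))
      = d w * real (card B) - (\<Sum>v\<in>A. real (deg_in E B v))"
    by (simp only: miss sum_subtractf sum_constant cardA)
  moreover have "d w * (1 + real (d w) + real (card B) + 2 * real k - 2 - eps) \<le> d w * q"
    using q_lower card_split by (intro mult_left_mono) auto
  ultimately show ?thesis
    by (simp add: algebra_simps power2_eq_square)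
qed

lemma slack_nonneg:
  "0 \<le> (\<Sum>v\<in>A. d v * (1 - y v))"
  "0 \<le> (2 * real k - 2) * d w - real (\<Sum>v\<in>A. deg_in E A v)"
  "0 \<le> (\<Sum>v\<in>A. real (card {b \<in> B. \<not> E v b}))"
proof -
  show "0 \<le> (\<Sum>v\<in>A. d v * (1 - y v))"
    using y_le nb_subset by (intro sum_nonneg mult_nonneg_nonneg) auto
  have "real (\<Sum>v\<in>A. deg_in E A v) \<le> real ((2 * k - 2) * d w)"
    using edges_A of_nat_mono by blast
  also have "\<dots> = (2 * real k - 2) * d w" using k3 by (simp add: of_nat_diff)
  finally show "0 \<le> (2 * real k - 2) * d w - real (\<Sum>v\<in>A. deg_in E A v)" by simp
  show "0 \<le> (\<Sum>v\<in>A. real (card {b \<in> B. \<not> E v b}))" by (intro sum_nonneg) simp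
qed

lemma slack_le:
  "(\<Sum>v\<in>A. d v * (1 - y v)) \<le> d w * eps"
  "(2 * real k - 2 - eps) * d w \<le> real (\<Sum>v\<in>A. deg_in E A v)"
  "(\<Sum>v\<in>A. real (card {b \<in> B. \<not> E v b})) \<le> d w * eps"
proof -
  show "(\<Sum>v\<in>A. d v * (1 - y v)) \<le> d w * eps"
    using tightness slack_nonneg by linarith
  show "(\<Sum>v\<in>A. real (card {b \<in> B. \<not> E v b})) \<le> d w * eps"
    using tightness slack_nonneg by linarith
  have "(2 * real k - 2) * d w - real (\<Sum>v\<in>A. deg_in E A v) \<le> d w * eps"
    using tightness slack_nonneg by linarith
  then show "(2 * real k - 2 - eps) * d w \<le> real (\<Sum>v\<in>A. deg_in E A v)"
    by (simp add: algebra_simps)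
qed

text \<open>The average degree inside \<open>A\<close> is at least \<open>2k - 2 - eps\<close> and
  at most \<open>d w - 1\<close>; integrality absorbs \<open>eps\<close>.\<close>

lemma deg_w_gt: "2 * k - 1 \<le> d w"
proof -
  have "(\<Sum>v\<in>A. deg_in E A v) \<le> (\<Sum>v\<in>A. d w - 1)"
    using deg_in_le_card[OF finite_nb irrE] cardA by (intro sum_mono) metis
  also have "\<dots> = d w * (d w - 1)" by (simp add: cardA)
  finally have "real (\<Sum>v\<in>A. deg_in E A v) \<le> real (d w * (d w - 1))"
    by (rule of_nat_mono)
  then have "(2 * real k - 2 - eps) * d w \<le> (real (d w) - 1) * d w"
    using slack_le(2) w(2) by (simp add: of_nat_diff algebra_simps)
  then have "2 * real k - 2 - eps \<le> real (d w) - 1"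
    using w(2) by (simp add: mult_le_cancel_right)
  then have "real (d w) > real (2 * k - 2)" using eps_le k3 by (simp add: of_nat_diff)
  then show ?thesis by simp
qed

section \<open>The vertex \<open>w\<close> is adjacent to all others\<close>

lemma deg_to_B:
  assumes "b \<in> B"
  shows "real (deg_in E A b) \<ge> (1 - eps) * d w"
proof -
  \<comment> \<open>Each non-neighbour of \<open>b\<close> in \<open>A\<close> accounts for one of
    the missing edges between \<open>A\<close> and \<open>B\<close>.\<close>
  have "card {v \<in> A. \<not> E b v} = (\<Sum>v\<in>A. if \<not> E b v then 1 else 0)"
    by (simp add: sum.If_cases Int_def)
  also have "\<dots> \<le> (\<Sum>v\<in>A. card {b \<in> B. \<not> E v b})"
  proof (intro sum_mono)
    fix v assume "v \<in> A"
    show "(if \<not> E b v then 1 else 0) \<le> card {b \<in> B. \<not> E v b}"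
    proof (cases "E b v")
      case False
      then have "{b} \<subseteq> {b \<in> B. \<not> E v b}" using assms E_sym by blast
      from card_mono[OF _ this] False finB show ?thesis by simp
    qed simp
  qed
  finally have "real (card {v \<in> A. \<not> E b v}) \<le> real (\<Sum>v\<in>A. card {b \<in> B. \<not> E v b})"
    by (rule of_nat_mono)
  also have "\<dots> \<le> d w * eps" using slack_le(3) by simp
  finally have "real (d w) - deg_in E A b \<le> d w * eps"
    using deg_in_le[OF finite_nb, of E w b] cardA
    by (simp only: card_nonadjacent[OF finite_nb] of_nat_diff)
  then show ?thesis by (simp add: algebra_simps)
qed

text \<open>A path on \<open>2k + 1\<close> vertices in \<open>insert b A\<close> loses its first or
  its last vertex to become a \<open>2k\<close>-path; as \<open>b\<close> occurs at most once, one
  of the two choices has both ends in \<open>A\<close>. So Erdos-Gallai applies with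
  \<open>r = 2k + 1\<close>. But adding \<open>b\<close> raises the degree sum by almost
  \<open>2 * d w\<close>, which is too much once \<open>d w \<ge> 3k\<close>.\<close>

lemma B_empty_large:
  assumes "d w \<ge> 3 * k"
  shows "B = {}"
proof (rule ccontr)
  assume "B \<noteq> {}"
  then obtain b where b: "b \<in> B" by blast
  let ?J = "insert b A"
  have bA: "b \<notin> A" using b by blast
  have sub: False if ys: "path_in E ?J ys" "length ys = 2 * k" "hd ys \<noteq> b" "last ys \<noteq> b" for ys
  proof -
    have "ys \<noteq> []" using ys(2) k3 by auto
    then have "hd ys \<in> set ys" "last ys \<in> set ys" by simp_all
    moreover have set: "set ys \<subseteq> ?J" "distinct ys" "successively E ys"
      using ys(1) by (simp_all add: path_in_def)
    ultimately have "E w (hd ys)" "E w (last ys)" using ys(3,4) by auto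
    moreover have "w \<notin> set ys" using set(1) b w_notin_A by auto
    ultimately show False using no_path_in_nbhd[of ys] ys(2) set(2,3) by simp
  qed
  have "length xs \<noteq> 2 * k + 1" if xs: "path_in E ?J xs" for xs
  proof
    assume l: "length xs = 2 * k + 1"
    have dist: "distinct xs" using xs unfolding path_in_def by auto
    have ne: "xs \<noteq> []" "drop 1 xs \<noteq> []" using l k3 by auto
    have ends: "hd (take (2 * k) xs) = xs ! 0" "last (take (2 * k) xs) = xs ! (2 * k - 1)"
      "hd (drop 1 xs) = xs ! 1" "last (drop 1 xs) = xs ! (2 * k)"
      using ne l k3 take_Suc_conv_app_nth[of "2 * k - 1" xs]
      by (simp_all add: hd_conv_nth hd_drop_conv_nth last_conv_nth nth_append)
    have 1: "xs ! 0 = b \<or> xs ! (2 * k - 1) = b"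
    proof (rule ccontr)
      assume "\<not> ?thesis"
      then show False
        using sub[OF path_in_take[OF xs, of "2 * k"]] l ends by simp
    qed
    have 2: "xs ! 1 = b \<or> xs ! (2 * k) = b"
    proof (rule ccontr)
      assume "\<not> ?thesis"
      then show False
        using sub[OF path_in_drop[OF xs, of 1]] l ends by simp
    qed
    have "xs ! i \<noteq> xs ! j" if "i < 2 * k + 1" "j < 2 * k + 1" "i \<noteq> j" for i j
      using nth_eq_iff_index_eq[OF dist] that l by simp
    then have "xs ! 0 \<noteq> xs ! 1" "xs ! 0 \<noteq> xs ! (2 * k)" "xs ! (2 * k - 1) \<noteq> xs ! 1"
      "xs ! (2 * k - 1) \<noteq> xs ! (2 * k)"
      using k3 by simp_all
    then show False using 1 2 by metis
  qed
  then have "(\<Sum>v\<in>?J. deg_in E ?J v) \<le> (2 * k + 1 - 2) * card ?J"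
    using k3 by (intro erdos_gallai_path[OF symE irrE]) auto
  moreover have "(\<Sum>v\<in>?J. deg_in E ?J v) = (\<Sum>v\<in>?J - {b}. deg_in E (?J - {b}) v) + 2 * deg_in E ?J b"
    by (intro sum_deg_in_remove symE irrE) auto
  moreover have "?J - {b} = A" using bA by auto
  moreover have "deg_in E ?J b = deg_in E A b"
    unfolding deg_in_def by (intro arg_cong[of _ _ card]) auto
  moreover have "card ?J = d w + 1" using bA cardA by simp
  ultimately have "(\<Sum>v\<in>A. deg_in E A v) + 2 * deg_in E A b \<le> (2 * k - 1) * (d w + 1)"
    by simp
  then have "real ((\<Sum>v\<in>A. deg_in E A v) + 2 * deg_in E A b) \<le> real ((2 * k - 1) * (d w + 1))"
    by (rule of_nat_mono)
  also have "\<dots> = (2 * real k - 1) * (real (d w) + 1)"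
    unfolding of_nat_mult using k3 by (simp add: of_nat_diff)
  finally have "(2 * real k - 2 - eps) * d w + 2 * ((1 - eps) * d w) \<le> (2 * real k - 1) * (real (d w) + 1)"
    using slack_le(2) deg_to_B[OF b] by simp
  then have "real (d w) - 3 * (eps * d w) \<le> 2 * real k - 1"
    by (simp add: algebra_simps)
  moreover have "eps * d w \<le> 1 / 55 * d w"
    using eps_le by (intro mult_right_mono) auto
  moreover have "real (d w) \<ge> 3 * real k" using assms by simp
  ultimately show False using k3_real by linarith
qed

text \<open>Here \<open>B\<close> is large, and more than \<open>6k\<close> of its vertices are
  adjacent to all of \<open>A\<close>. Starting with an edge \<open>a1 a2\<close> inside
  \<open>A\<close> and then alternating between \<open>A\<close> and \<open>B0\<close> gives a
  \<open>2k\<close>-path with both ends in \<open>A\<close>; \<open>deg_w_gt\<close> supplies enough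
  vertices of \<open>A\<close>.\<close>

lemma B_empty_small:
  assumes "d w < 3 * k"
  shows False
proof -
  define B0 where "B0 = {b \<in> B. \<forall>v\<in>A. E v b}"
  have "B - B0 = (\<Union>v\<in>A. {b \<in> B. \<not> E v b})" by (auto simp: B0_def)
  then have "card (B - B0) \<le> (\<Sum>v\<in>A. card {b \<in> B. \<not> E v b})"
    by (simp add: card_UN_le)
  then have "real (card (B - B0)) \<le> real (\<Sum>v\<in>A. card {b \<in> B. \<not> E v b})"
    by (rule of_nat_mono)
  also have "\<dots> \<le> d w * eps" using slack_le(3) by simp
  also have "\<dots> \<le> d w * (1 / 55)" using eps_le by (intro mult_left_mono) auto
  finally have "card (B - B0) < k" using assms by simp
  moreover have "card B0 = card B - card (B - B0)"
  proof -
    have "B0 \<subseteq> B" by (auto simp: B0_def)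
    then show ?thesis
      using card_Diff_subset[OF finite_subset[OF _ finB]] card_mono[OF finB] by (metis diff_diff_cancel finB)
  qed
  ultimately have B0: "card B0 > 6 * k" using card_split assms n_ge_k_nat k3 by linarith
  have link: "\<exists>b. b \<notin> X \<and> E l b \<and> E b l'"
    if "l \<in> A" "l' \<in> A" "finite X" "card X \<le> 6 * k" for l l' X
  proof -
    have "\<not> B0 \<subseteq> X" using card_mono[OF \<open>finite X\<close>, of B0] that(4) B0 by linarith
    then obtain b where b: "b \<in> B0" "b \<notin> X" by blast
    then have "E l b" "E l' b" using that(1,2) unfolding B0_def by blast+
    then show ?thesis using b(2) E_sym by blast
  qed
  have "0 < (2 * real k - 2 - eps) * d w"
    using eps_le k3_real w(2) by (intro mult_pos_pos) auto
  then have "(\<Sum>v\<in>A. deg_in E A v) \<noteq> 0" using slack_le(2) by linarith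
  then obtain a2 where a2: "a2 \<in> A" "deg_in E A a2 \<noteq> 0" by (meson sum.neutral)
  then obtain a1 where a1: "a1 \<in> A" "E a2 a1"
    unfolding deg_in_def by (metis (no_types, lifting) Collect_empty_eq card.empty)
  then have "a1 \<noteq> a2" by auto
  have "card (A - {a1, a2}) = d w - 2"
    using a1 a2 \<open>a1 \<noteq> a2\<close> cardA by (subst card_Diff_subset) auto
  then have "k - 1 \<le> card (A - {a1, a2})" using deg_w_gt k3 by linarith
  then obtain C where C: "C \<subseteq> A - {a1, a2}" "card C = k - 1" "finite C"
    by (meson finite_Diff finite_nb obtain_subset_with_card_n)
  obtain cs where cs: "set cs = C" "distinct cs" using finite_distinct_list[OF C(3)] by blast
  have lcs: "length cs = k - 1" using cs C by (metis distinct_card)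
  have cardF: "card (insert w A) = d w + 1" using cardA by simp
  \<comment> \<open>Avoiding \<open>insert w A\<close> keeps \<open>w\<close> and \<open>a1\<close>
    off the path. This set has at most \<open>3k\<close> elements, so \<open>6k\<close> leaves ample
    room.\<close>
  have "\<exists>xs. distinct xs \<and> successively E xs \<and> xs \<noteq> [] \<and> hd xs = hd (a2 # cs) \<and>
      last xs = last (a2 # cs) \<and> length xs + 1 = 2 * length (a2 # cs) \<and>
      set xs \<inter> insert w A = set (a2 # cs)"
    using cs C a2 cardF lcs assms k3
    by (intro zigzag_path[OF symE, of A "6 * k"] link) auto
  then obtain xs where xs: "distinct xs" "successively E xs" "xs \<noteq> []" "hd xs = a2"
    "last xs = last (a2 # cs)" "length xs + 1 = 2 * k" "set xs \<inter> insert w A = set (a2 # cs)"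
    using lcs k3 by auto
  have "a1 \<notin> set (a2 # cs)" "w \<notin> set (a2 # cs)"
    using a1 a2 \<open>a1 \<noteq> a2\<close> C cs w_notin_A by auto
  then have "a1 \<notin> set xs" "w \<notin> set xs"
    using xs(7) a1(1) by blast+
  moreover have "last xs \<in> A"
  proof -
    have "last (a2 # cs) \<in> set (a2 # cs)" by (rule last_in_set) simp
    then show ?thesis using xs(5) a2 C cs by auto
  qed
  moreover have "w \<noteq> a1" using a1(1) by auto
  ultimately show False
    using no_path_in_nbhd[of "a1 # xs"] xs a1 E_sym by (auto simp: successively_Cons)
qed

lemma w_dominating: "B = {}"
  using B_empty_large B_empty_small by fastforce

section \<open>Global estimates for degrees and for \<open>y\<close>\<close>

lemma d_w: "d w = n - 1" and A_eq: "A = V - {w}"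
  using card_split V_split w_notin_A unfolding w_dominating by auto

lemma d_w_real: "real (d w) = real n - 1"
  using d_w n_pos by (simp add: of_nat_diff)

lemma d_le: "d v \<le> n"
  using deg_in_le[OF fin, of E v] n_card by simp

lemma w_adj: "v \<in> V \<Longrightarrow> v \<noteq> w \<Longrightarrow> E w v"
  using A_eq by auto

lemma eps_n_le: "2 * real k * (real k - 1) \<le> real n / 55"
  using eps_mult eps_le n_pos mult_left_mono[of eps "1 / 55" "real n"] by simp

text \<open>The first slack bound, now over all of \<open>V\<close>: the term of \<open>w\<close>
  vanishes because \<open>y w = 1\<close>, and \<open>d w * eps \<le> n * eps\<close>.\<close>

lemma sum_delta: "(\<Sum>v\<in>V. d v * (1 - y v)) \<le> 2 * real k * (real k - 1)"
proof -
  have "(\<Sum>v\<in>V. d v * (1 - y v)) = (\<Sum>v\<in>A. d v * (1 - y v))"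
    using w(1,3) fin unfolding A_eq by (simp add: sum.remove)
  also have "\<dots> \<le> d w * eps" by (rule slack_le)
  also have "\<dots> \<le> real n * eps" using eps_nonneg d_le by (intro mult_right_mono) auto
  finally show ?thesis using eps_mult by simp
qed

lemma delta_nonneg: "v \<in> V \<Longrightarrow> 0 \<le> d v * (1 - y v)"
  using y_le by simp

lemma delta_le: "v \<in> V \<Longrightarrow> d v * (1 - y v) \<le> 2 * real k * (real k - 1)"
  using member_le_sum[of v V "\<lambda>v. d v * (1 - y v)"] delta_nonneg fin sum_delta by force

lemma edges_A_lower: "(2 * real k - 2) * (real n - 1) - 2 * real k * (real k - 1) \<le> real (\<Sum>v\<in>A. deg_in E A v)"
proof -
  have "d w * eps \<le> real n * eps" using eps_nonneg d_le by (intro mult_right_mono) auto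
  then show ?thesis using slack_le(2) eps_mult by (simp add: algebra_simps d_w_real)
qed

lemma deg_A: "v \<in> A \<Longrightarrow> d v = 1 + deg_in E A v"
  using deg_split[of v] unfolding w_dominating by (simp add: deg_in_def)

lemma edges_A_real: "real (\<Sum>v\<in>A. deg_in E A v) \<le> (2 * real k - 2) * (real n - 1)"
  using slack_nonneg(2) d_w_real by simp

lemma sum_A_deg: "(\<Sum>v\<in>A. real (d v)) \<le> (2 * real k - 1) * (real n - 1)"
proof -
  have "(\<Sum>v\<in>A. real (d v)) = (\<Sum>v\<in>A. 1 + real (deg_in E A v))"
    by (intro sum.cong) (auto simp: deg_A)
  also have "\<dots> = real n - 1 + real (\<Sum>v\<in>A. deg_in E A v)"
    by (simp add: sum.distrib cardA d_w_real)
  also have "\<dots> \<le> (2 * real k - 1) * (real n - 1)"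
    using edges_A_real by (simp add: algebra_simps)
  finally show ?thesis .
qed

lemma sum_deg: "(\<Sum>v\<in>V. real (d v)) \<le> 2 * real k * real n"
proof -
  have "(\<Sum>v\<in>V. real (d v)) = real (d w) + (\<Sum>v\<in>A. real (d v))"
    using w(1) fin unfolding A_eq by (simp add: sum.remove)
  also have "\<dots> \<le> (real n - 1) + (2 * real k - 1) * (real n - 1)"
    using sum_A_deg d_w_real by simp
  also have "\<dots> \<le> 2 * real k * real n" using k3_real by (simp add: algebra_simps)
  finally show ?thesis .
qed

lemma q_bounds: "real n \<le> q" "q \<le> 3 / 2 * real n"
proof -
  show "real n \<le> q" using q_lower eps_le k3_real by linarith
  have "q * d w \<le> (d w)\<^sup>2 + (\<Sum>v\<in>A. d v * y v)"
    using eig[OF w(1)] w(3) by simp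
  also have "(\<Sum>v\<in>A. d v * y v) \<le> (\<Sum>v\<in>A. real (d v) * 1)"
    using y_le A_eq by (intro sum_mono mult_left_mono) auto
  also have "(d w)\<^sup>2 + (\<Sum>v\<in>A. real (d v) * 1) \<le> (real n - 1 + (2 * real k - 1)) * d w"
    using sum_A_deg by (simp add: d_w_real power2_eq_square algebra_simps)
  finally have "q \<le> real n - 1 + (2 * real k - 1)"
    using w(2) by (simp add: mult_le_cancel_right)
  then show "q \<le> 3 / 2 * real n" using n_ge_k k3_real by linarith
qed

text \<open>Source of a dichotomy: the right-hand side is at most \<open>2kn\<close>, so a large
  \<open>d v * y v\<close> forces \<open>d v\<close> close to \<open>q\<close>.\<close>

lemma nbr_deg_sum: "v \<in> V \<Longrightarrow> (q - d v) * (d v * y v) \<le> (\<Sum>u\<in>nb v. real (d u))"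
proof -
  assume v: "v \<in> V"
  have "(\<Sum>u\<in>nb v. d u * y u) \<le> (\<Sum>u\<in>nb v. real (d u) * 1)"
    using y_le nb_subset by (intro sum_mono mult_left_mono) auto
  then show ?thesis using eig[OF v] by (simp add: algebra_simps power2_eq_square)
qed

lemma nbr_deg_sum_le: "(\<Sum>u\<in>nb v. real (d u)) \<le> 2 * real k * real n"
proof -
  have "(\<Sum>u\<in>nb v. real (d u)) \<le> (\<Sum>u\<in>V. real (d u))"
    using nb_subset fin by (intro sum_mono2) auto
  then show ?thesis using sum_deg by linarith
qed

section \<open>Vertices of degree at least \<open>n/2\<close>, and the few edges avoiding
  them\<close>

definition L where "L = {v \<in> V. n \<le> 2 * d v}"

lemma L_subset: "L \<subseteq> V" by (auto simp: L_def)
lemma finite_L: "finite L" using L_subset fin finite_subset by blast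
lemma w_in_L: "w \<in> L" using w(1) d_w n_ge_k_nat k3 by (simp add: L_def)

lemma y_L: "v \<in> L \<Longrightarrow> y v \<ge> 53 / 55"
proof -
  assume v: "v \<in> L"
  then have n2: "real n \<le> 2 * real (d v)" unfolding L_def by (simp flip: of_nat_mult)
  have "v \<in> V" using v by (simp add: L_def)
  then have "real n / 2 * (1 - y v) \<le> d v * (1 - y v)"
    using n2 y_le by (intro mult_right_mono) auto
  also have "\<dots> \<le> real n / 55" using delta_le[OF \<open>v \<in> V\<close>] eps_n_le by linarith
  also have "\<dots> = real n / 2 * (2 / 55)" by simp
  finally have "1 - y v \<le> 2 / 55" using n_pos by (subst (asm) mult_le_cancel_left) auto
  then show ?thesis by simp
qed

lemma d_L: "v \<in> L \<Longrightarrow> n \<le> d v + 5 * k"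
proof -
  assume v: "v \<in> L"
  then have n2: "real n \<le> 2 * real (d v)" unfolding L_def by (simp flip: of_nat_mult)
  have vV: "v \<in> V" using v by (simp add: L_def)
  have qd: "0 \<le> q - d v" using q_bounds d_le[of v] by (smt (verit) of_nat_le_iff)
  have "(q - d v) * (real n / 2 * (53 / 55)) \<le> (q - d v) * (d v * y v)"
    using qd n2 y_L[OF v] by (intro mult_left_mono mult_mono) auto
  also have "\<dots> \<le> 2 * real k * real n"
    using nbr_deg_sum[OF vV] nbr_deg_sum_le[of v] by linarith
  \<comment> \<open>The common factor cancels and leaves
    \<open>q - d v \<le> 4k * 55/53 < 5k\<close>.\<close>
  also have "\<dots> = (4 * real k * (55 / 53)) * (real n / 2 * (53 / 55))" by simp
  finally have "q - d v \<le> 4 * real k * (55 / 53)"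
    using n_pos by (subst (asm) mult_le_cancel_right) auto
  then have "real n \<le> real (d v + 5 * k)" using q_bounds k3_real by simp
  then show ?thesis by linarith
qed

abbreviation N where "N \<equiv> V - L"

text \<open>A neighbour \<open>u\<close> outside \<open>L\<close> has \<open>n - d u > n/2\<close>,
  so many such neighbours would make the degree sum over \<open>nb v\<close> smaller than
  \<open>nbr_deg_sum\<close> permits.\<close>

lemma deg_N_le:
  assumes v: "v \<in> V"
  shows "deg_in E N v \<le> 2 / real n * ((d v)\<^sup>2 + q * (d v * (1 - y v)))"
proof -
  have "deg_in E N v * (real n / 2) = (\<Sum>u\<in>{u \<in> N. E v u}. real n / 2)"
    by (simp add: deg_in_def)
  also have "\<dots> \<le> (\<Sum>u\<in>{u \<in> N. E v u}. real n - d u)"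
  proof (intro sum_mono)
    fix u assume "u \<in> {u \<in> N. E v u}"
    then have "2 * d u < n" by (auto simp: L_def)
    then have "real (2 * d u) < real n" by (simp only: of_nat_less_iff)
    then show "real n / 2 \<le> real n - d u" by simp
  qed
  also have "\<dots> \<le> (\<Sum>u\<in>nb v. real n - d u)"
    using d_le by (intro sum_mono2) auto
  also have "\<dots> = real n * d v - (\<Sum>u\<in>nb v. real (d u))"
    by (simp add: sum_subtractf card_nb)
  also have "\<dots> \<le> q * d v - (q - d v) * (d v * y v)"
  proof -
    have "real n * d v \<le> q * d v" using q_bounds by (intro mult_right_mono) auto
    then show ?thesis using nbr_deg_sum[OF v] by linarith
  qed
  also have "\<dots> = (d v)\<^sup>2 * y v + q * (d v * (1 - y v))"
    by (simp add: algebra_simps power2_eq_square)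
  also have "\<dots> \<le> (d v)\<^sup>2 + q * (d v * (1 - y v))"
    using mult_left_mono[OF y_le[OF v], of "real ((d v)\<^sup>2)"] by simp
  finally show ?thesis using n_pos by (simp add: field_simps)
qed

text \<open>Linear in \<open>d v\<close> and \<open>d v * (1 - y v)\<close>, hence summable with
  \<open>sum_deg\<close> and \<open>sum_delta\<close>. For \<open>d v \<le> 6k\<close> the square in
  \<open>deg_N_le\<close> is at most \<open>6k * d v\<close>; otherwise \<open>1 - y v\<close> is
  bounded below and \<open>deg_in E N v \<le> d v\<close> suffices. The cases give the factors 3 and
  4, both covered by 7.\<close>

lemma deg_N_pointwise:
  assumes v: "v \<in> N"
  shows "deg_in E N v \<le> 12 * real k / real n * d v + 7 * (d v * (1 - y v))"
proof -
  have vV: "v \<in> V" using v by simp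
  note \<delta> = delta_nonneg[OF vV]
  show ?thesis
  proof (cases "d v \<le> 6 * k")
    case True
    then have "real (d v) \<le> 6 * real k" by (metis of_nat_le_iff of_nat_mult of_nat_numeral)
    then have 1: "(real (d v))\<^sup>2 \<le> 6 * real k * d v"
      unfolding power2_eq_square by (intro mult_right_mono) auto
    have 2: "q * (d v * (1 - y v)) \<le> 3 / 2 * real n * (d v * (1 - y v))"
      using q_bounds(2) \<delta> by (intro mult_right_mono) auto
    have "deg_in E N v \<le> 2 / real n * ((d v)\<^sup>2 + q * (d v * (1 - y v)))"
      by (rule deg_N_le[OF vV])
    also have "\<dots> \<le> 2 / real n * (6 * real k * d v + 3 / 2 * real n * (d v * (1 - y v)))"
      using 1 2 n_pos by (intro mult_left_mono add_mono) auto
    also have "\<dots> = 12 * real k / real n * d v + 3 * (d v * (1 - y v))"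
      using n_pos by (simp add: field_simps)
    finally show ?thesis using \<delta> by linarith
  next
    case False
    then have d6: "real (d v) > 6 * real k" by (metis not_le of_nat_less_iff of_nat_mult of_nat_numeral)
    have "2 * d v < n" using v by (auto simp: L_def)
    then have "real (2 * d v) < real n" by (simp only: of_nat_less_iff)
    then have dn: "real n / 2 \<le> q - d v" using q_bounds by simp
    \<comment> \<open>Otherwise the left side of \<open>nbr_deg_sum\<close> would be at least
      \<open>9/4 * kn\<close>, above the bound \<open>2kn\<close>.\<close>
    have "y v \<le> 3 / 4"
    proof (rule ccontr)
      assume "\<not> ?thesis"
      then have "real n / 2 * (6 * real k * (3 / 4)) \<le> (q - d v) * (d v * y v)"
        using d6 dn n_pos k3_real by (intro mult_mono) auto
      also have "\<dots> \<le> 2 * real k * real n"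
        using nbr_deg_sum[OF vV] nbr_deg_sum_le[of v] by linarith
      finally have "real n * real k * (9 / 4) \<le> real n * real k * 2" by simp
      moreover have "real n * real k > 0" using n_pos k3_real by simp
      ultimately show False by linarith
    qed
    then have "real (d v) * (1 / 4) \<le> d v * (1 - y v)" by (intro mult_left_mono) auto
    moreover have "real (deg_in E N v) \<le> d v"
      unfolding deg_in_def using fin by (intro of_nat_mono card_mono) auto
    moreover have "0 \<le> 12 * real k / real n * d v" by simp
    ultimately show ?thesis using \<delta> by linarith
  qed
qed

lemma sum_deg_N: "(\<Sum>v\<in>N. real (deg_in E N v)) \<le> 24 * (real k)\<^sup>2 + 14 * (real k * (real k - 1))"
proof -
  have "(\<Sum>v\<in>N. real (deg_in E N v)) \<le> (\<Sum>v\<in>N. 12 * real k / real n * d v + 7 * (d v * (1 - y v)))"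
    by (intro sum_mono deg_N_pointwise)
  also have "\<dots> \<le> (\<Sum>v\<in>V. 12 * real k / real n * d v + 7 * (d v * (1 - y v)))"
    using fin delta_nonneg by (intro sum_mono2 add_nonneg_nonneg) auto
  also have "\<dots> = 12 * real k / real n * (\<Sum>v\<in>V. real (d v)) + 7 * (\<Sum>v\<in>V. d v * (1 - y v))"
    by (simp only: sum.distrib sum_distrib_left)
  also have "\<dots> \<le> 12 * real k / real n * (2 * real k * real n) + 7 * (2 * real k * (real k - 1))"
    using sum_deg sum_delta by (intro add_mono mult_left_mono) auto
  also have "\<dots> = 24 * (real k)\<^sup>2 + 14 * (real k * (real k - 1))"
    using n_pos by (simp add: power2_eq_square)
  finally show ?thesis .
qed

text \<open>With at most \<open>k - 2\<close> vertices of \<open>L\<close> besides \<open>w\<close>,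
  the degree sum inside \<open>A\<close> would be at most \<open>2(k - 2)(n - 1)\<close> plus the
  quadratic term of \<open>sum_deg_N\<close>. By \<open>edges_A_lower\<close> this leaves
  \<open>2(n - 1) \<le> 40k^2\<close>, against \<open>n \<ge> 110k^2\<close>.\<close>

lemma card_L_ge: "k \<le> card L"
proof (rule ccontr)
  assume "\<not> k \<le> card L"
  let ?L = "L - {w}"
  have cL: "card ?L = card L - 1" using w_in_L finite_L by simp
  have "card L > 0" using w_in_L finite_L card_gt_0_iff by blast
  with \<open>\<not> k \<le> card L\<close> cL have "card ?L \<le> k - 2" by linarith
  then have "real (card ?L) \<le> real (k - 2)" by (rule of_nat_mono)
  then have cL2: "real (card ?L) \<le> real k - 2" using k3 by (simp add: of_nat_diff)
  have A_split: "A = ?L \<union> N" and dis: "?L \<inter> N = {}" using A_eq L_subset w_in_L by auto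
  have fL: "finite ?L" and fN: "finite N" using finite_L fin by auto
  have cN: "real (card N) \<le> real n - 1"
  proof -
    have "N \<subseteq> A" using A_split by blast
    then have "card N \<le> card A" by (intro card_mono) auto
    then show ?thesis using cardA d_w_real by linarith
  qed
  have degA: "deg_in E A v = deg_in E ?L v + deg_in E N v" for v
    unfolding A_split by (rule deg_in_Un[OF fL fN dis])
  have "(\<Sum>v\<in>A. real (deg_in E A v)) = (\<Sum>v\<in>?L. real (deg_in E A v)) + (\<Sum>v\<in>N. real (deg_in E A v))"
    by (subst A_split, rule sum.union_disjoint[OF fL fN dis])
  also have "(\<Sum>v\<in>?L. real (deg_in E A v)) \<le> (\<Sum>v\<in>?L. real n - 1)"
    using deg_in_le[of A E] cardA d_w_real by (intro sum_mono) (metis finite_nb of_nat_mono)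
  also have "(\<Sum>v\<in>N. real (deg_in E A v)) = (\<Sum>v\<in>N. real (deg_in E ?L v)) + (\<Sum>v\<in>N. real (deg_in E N v))"
    by (simp add: degA sum.distrib)
  also have "(\<Sum>v\<in>N. real (deg_in E ?L v)) \<le> (\<Sum>v\<in>N. real (card ?L))"
    using deg_in_le[OF fL] by (intro sum_mono) simp
  also have "(\<Sum>v\<in>N. real (card ?L)) \<le> (real n - 1) * card ?L"
    using cN by (simp add: mult_right_mono)
  also have "(\<Sum>v\<in>?L. real n - 1) = (real n - 1) * card ?L" by simp
  finally have "(\<Sum>v\<in>A. real (deg_in E A v)) \<le> 2 * ((real n - 1) * card ?L)
      + (24 * (real k)\<^sup>2 + 14 * (real k * (real k - 1)))"
    using sum_deg_N by linarith
  moreover have "(real n - 1) * card ?L \<le> (real n - 1) * (real k - 2)"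
    using cL2 n_ge_k k3_real by (intro mult_left_mono) auto
  moreover have "(2 * real k - 2) * (real n - 1) = 2 * ((real n - 1) * (real k - 2)) + 2 * (real n - 1)"
    by (simp add: algebra_simps)
  moreover have "real k * (real k - 1) \<le> (real k)\<^sup>2"
    by (simp add: power2_eq_square algebra_simps)
  ultimately have "2 * (real n - 1) \<le> 40 * (real k)\<^sup>2"
    using edges_A_lower by simp
  moreover have "40 * (real k)\<^sup>2 \<le> 40 / 110 * real n" using n_ge_real by simp
  moreover have "real n \<ge> 990" using n_ge_k k3_real by linarith
  ultimately show False by simp
qed

section \<open>Forcing the structure of \<open>S_graph n k\<close>\<close>

lemma card_nonnbr: "v \<in> L \<Longrightarrow> card (V - nb v) \<le> 5 * k"
  using d_L[of v] card_Diff_subset[OF finite_nb nb_subset, of v] card_nb[of v] n_card by simp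

lemma L_linked:
  assumes "l \<in> L" "l' \<in> L" "finite X" "card X \<le> 2 * k"
  shows "\<exists>b. b \<notin> X \<and> E l b \<and> E b l'"
proof -
  have "card (X \<union> ((V - nb l) \<union> (V - nb l'))) \<le> card X + (card (V - nb l) + card (V - nb l'))"
    by (meson card_Un_le add_left_mono order_trans)
  also have "\<dots> < card V"
    using card_nonnbr[OF assms(1)] card_nonnbr[OF assms(2)] assms(4) n_card n_ge_k_nat k3 by linarith
  finally have "\<not> V \<subseteq> X \<union> ((V - nb l) \<union> (V - nb l'))"
    using card_mono[of "X \<union> ((V - nb l) \<union> (V - nb l'))" V] assms(3) fin by auto
  then show ?thesis using E_sym by blast
qed

text \<open>A zigzag from \<open>l\<close> to \<open>w\<close> through all of \<open>L0\<close> has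
  \<open>2k - 1\<close> vertices. Since \<open>w\<close> is dominating, the detour
  \<open>w, b, a, l\<close> closes it to length \<open>2k + 1\<close>.\<close>

lemma no_edge_outside:
  assumes L0: "L0 \<subseteq> L" "w \<in> L0" "card L0 = k"
    and ab: "a \<notin> L0" "b \<notin> L0" "E a b" and l: "l \<in> L0" "l \<noteq> w" "E a l"
  shows False
proof -
  have fL0: "finite L0" using L0(1) finite_L finite_subset by blast
  obtain cs where cs: "set cs = L0 - {l, w}" "distinct cs"
    using finite_distinct_list[of "L0 - {l, w}"] fL0 by auto
  let ?ls = "l # cs @ [w]"
  have ls: "distinct ?ls" "set ?ls = L0" using cs l L0 by auto
  then have len: "length ?ls = k" using L0(3) distinct_card by metis
  have "card ({a, b} \<union> L0) \<le> card {a, b} + card L0" by (rule card_Un_le)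
  also have "card {a, b} \<le> 2" by (simp add: card_insert_if)
  finally have F: "card ({a, b} \<union> L0) \<le> k + 2" using L0(3) by simp
  have "\<exists>xs. distinct xs \<and> successively E xs \<and> xs \<noteq> [] \<and> hd xs = hd ?ls \<and>
      last xs = last ?ls \<and> length xs + 1 = 2 * length ?ls \<and> set xs \<inter> ({a, b} \<union> L0) = set ?ls"
  proof (rule zigzag_path[OF symE, of L "2 * k"])
    show "\<exists>b. b \<notin> X \<and> E l b \<and> E b l'"
      if "l \<in> L" "l' \<in> L" "finite X" "card X \<le> 2 * k" for l l' X
      using L_linked that .
    show "card ({a, b} \<union> L0) + length ?ls \<le> 2 * k + 2" using F len by linarith
  qed (use ls L0 fL0 in auto)
  then obtain xs where xs: "distinct xs" "successively E xs" "xs \<noteq> []" "hd xs = l"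
    "last xs = w" "length xs + 1 = 2 * k" "set xs \<inter> ({a, b} \<union> L0) = L0"
    using len ls(2) by auto
  have "a \<notin> set xs" "b \<notin> set xs" using xs(7) ab by blast+
  moreover have "E w b" using w_adj[of b] ab EV2 L0(2) by blast
  moreover have "a \<noteq> b" using ab by auto
  ultimately show False
    using no_cycle[of "b # a # xs"] xs ab l E_sym k3 by (auto simp: successively_Cons)
qed

lemma extremal_structure:
  obtains L0 where "L0 \<subseteq> V" "card L0 = k"
    "\<And>u v. u \<in> V \<Longrightarrow> v \<in> V \<Longrightarrow> E u v \<longleftrightarrow> u \<noteq> v \<and> (u \<in> L0 \<or> v \<in> L0)"
proof -
  have "k - 1 \<le> card (L - {w})" using card_L_ge w_in_L finite_L by simp
  then obtain L1 where L1: "L1 \<subseteq> L - {w}" "card L1 = k - 1" "finite L1"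
    by (meson finite_Diff finite_L obtain_subset_with_card_n)
  define L0 where "L0 = insert w L1"
  have L0: "L0 \<subseteq> L" "w \<in> L0" "card L0 = k"
    using L1 w_in_L k3 by (auto simp: L0_def card_insert_if)
  have fL0: "finite L0" and L0V: "L0 \<subseteq> V" using L0(1) finite_L L_subset finite_subset by auto
  have "L1 \<noteq> {}" using L1(2) k3 by auto
  then obtain l1 where l1: "l1 \<in> L0" "l1 \<noteq> w" using L1(1) by (auto simp: L0_def)
  note no_edge = no_edge_outside[OF L0]

  let ?\<mu> = "S_mu n k"
  define \<zeta> where "\<zeta> = real k / (?\<mu> - real k)"
  have "k \<ge> 1" "n \<ge> 2 * k\<^sup>2" using k3 n_ge by auto
  note mu = S_mu_equations[OF this, folded \<zeta>_def]
  note mk = mu(1) and outside = mu(2) and inside = mu(3)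
  have "real k \<le> (real k)\<^sup>2" using k3_real by (simp add: power2_eq_square)
  then have k2: "10 * (real k)\<^sup>2 \<le> ?\<mu> - real k" using mu_ge n_ge_real k3_real by linarith
  have \<zeta>0: "0 < \<zeta>" using mk k3_real by (simp add: \<zeta>_def)
  \<comment> \<open>Needed below in the form that \<open>5k\<close> neighbours, each contributing
    \<open>2 * \<zeta>\<close>, contribute at most 1 in total.\<close>
  have \<zeta>1: "10 * real k * \<zeta> \<le> 1"
    using k2 mk by (simp add: \<zeta>_def power2_eq_square field_simps)

  txt \<open>
    \<open>P = \<mu> z - Q(G) z\<close> is nonnegative because \<open>\<mu> z\<close> is \<open>Q(S\<^sub>n\<^sub>,\<^sub>k) z\<close>, and an edge of \<open>G\<close> outside
    \<open>L\<^sub>0\<close> costs its ends all but one of their neighbours in \<open>L\<^sub>0\<close>.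
  \<close>
  define z where "z v = (if v \<in> L0 then 1 else \<zeta>)" for v
  define P where "P v = ?\<mu> * z v - (\<Sum>u\<in>nb v. z v + z u)" for v
  have z_pos: "0 < z v" for v using \<zeta>0 by (simp add: z_def)
  have sum_z: "(\<Sum>u\<in>V. z u) = real k + (real n - real k) * \<zeta>"
  proof -
    have "(\<Sum>u\<in>V. z u) = (\<Sum>u\<in>V - L0. z u) + (\<Sum>u\<in>L0. z u)"
      using L0V fin by (rule sum.subset_diff)
    also have "(\<Sum>u\<in>L0. z u) = real k" by (simp add: z_def L0(3))
    also have "(\<Sum>u\<in>V - L0. z u) = (\<Sum>u\<in>V - L0. \<zeta>)" by (intro sum.cong) (auto simp: z_def)
    also have "\<dots> = (real n - real k) * \<zeta>"
      using fL0 L0V L0(3) n_card card_mono[OF fin L0V] by (simp add: card_Diff_subset of_nat_diff)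
    finally show ?thesis by simp
  qed
  have P_in: "P v = (\<Sum>u\<in>V - {v} - nb v. 1 + z u)" if "v \<in> L0" for v
  proof -
    have vV: "v \<in> V" using that L0V by blast
    have zv: "z v = 1" using that by (simp add: z_def)
    have "(\<Sum>u\<in>V - {v}. 1 + z u) = (\<Sum>u\<in>V. 1 + z u) - (1 + z v)"
      using sum.remove[OF fin vV, of "\<lambda>u. 1 + z u"] by linarith
    also have "\<dots> = ?\<mu>" using inside by (simp add: sum.distrib sum_z n_card zv)
    finally have "?\<mu> = (\<Sum>u\<in>V - {v}. 1 + z u)" ..
    also have "\<dots> = (\<Sum>u\<in>V - {v} - nb v. 1 + z u) + (\<Sum>u\<in>nb v. 1 + z u)"
      using nb_subset fin by (intro sum.subset_diff) auto
    finally show ?thesis by (simp add: P_def zv)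
  qed
  have P_out: "0 \<le> P v" if v: "v \<in> V - L0" for v
  proof -
    have zv: "z v = \<zeta>" using v by (simp add: z_def)
    have "(\<Sum>u\<in>nb v. \<zeta> + z u) \<le> real k * (1 + \<zeta>)"
    proof (cases "nb v \<subseteq> L0")
      case True
      then have "(\<Sum>u\<in>nb v. \<zeta> + z u) = (\<Sum>u\<in>nb v. \<zeta> + 1)"
        by (intro sum.cong) (auto simp: z_def)
      also have "\<dots> = card (nb v) * (1 + \<zeta>)" by simp
      also have "\<dots> \<le> real k * (1 + \<zeta>)"
        using \<zeta>0 card_mono[OF fL0 True] L0(3) by (intro mult_right_mono) auto
      finally show ?thesis .
    next
      case False
      then obtain b where b: "E v b" "b \<notin> L0" by auto
      have wv: "w \<in> nb v" using w_adj[of v] v L0(2) E_sym by auto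
      have only_w: "u \<notin> L0" if "u \<in> nb v - {w}" for u
        using no_edge[of v b u] v b that by auto
      \<comment> \<open>A neighbour \<open>u\<close> of \<open>v\<close> that is adjacent to
        \<open>l1\<close> would make \<open>u v\<close> an edge forbidden by \<open>no_edge\<close>.
        So there are at most \<open>5k\<close> such \<open>u\<close>.\<close>
      have "nb v - {w} \<subseteq> V - nb l1"
      proof
        fix u assume u: "u \<in> nb v - {w}"
        then have "\<not> E u l1"
          using no_edge[of u v l1] only_w[OF u] v l1 E_sym by auto
        then show "u \<in> V - nb l1" using u EV2 E_sym by auto
      qed
      then have "card (nb v - {w}) \<le> card (V - nb l1)" using fin by (intro card_mono) auto
      also have "\<dots> \<le> 5 * k" using card_nonnbr l1(1) L0(1) by blast
      finally have c: "real (card (nb v - {w})) \<le> 5 * real k" by (metis of_nat_le_iff of_nat_mult of_nat_numeral)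
      have "(\<Sum>u\<in>nb v. \<zeta> + z u) = \<zeta> + z w + (\<Sum>u\<in>nb v - {w}. \<zeta> + z u)"
        by (rule sum.remove[OF finite_nb wv])
      also have "(\<Sum>u\<in>nb v - {w}. \<zeta> + z u) = (\<Sum>u\<in>nb v - {w}. 2 * \<zeta>)"
        using only_w by (intro sum.cong) (auto simp: z_def)
      also have "\<dots> = card (nb v - {w}) * (2 * \<zeta>)" by simp
      also have "\<dots> \<le> 5 * real k * (2 * \<zeta>)" using c \<zeta>0 by (intro mult_right_mono) auto
      also have "\<dots> \<le> 1" using \<zeta>1 by simp
      finally have "(\<Sum>u\<in>nb v. \<zeta> + z u) \<le> \<zeta> + 2" using L0(2) by (simp add: z_def)
      also have "\<dots> \<le> 2 * (1 + \<zeta>)" using \<zeta>0 by simp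
      also have "\<dots> \<le> real k * (1 + \<zeta>)" using k3_real \<zeta>0 by (intro mult_right_mono) auto
      finally show ?thesis .
    qed
    then show ?thesis using outside by (simp add: P_def zv)
  qed
  have P_nonneg: "0 \<le> P v" if "v \<in> V" for v
  proof (cases "v \<in> L0")
    case True
    have "0 \<le> (\<Sum>u\<in>V - {v} - nb v. 1 + z u)"
      using z_pos by (intro sum_nonneg) (simp add: less_imp_le)
    then show ?thesis using P_in[OF True] by simp
  qed (use P_out that in auto)

  define x where "x v = d v * y v" for v
  have x_nonneg: "0 \<le> x v" if "v \<in> V" for v using y_nonneg[OF that] by (simp add: x_def)
  have swap: "(\<Sum>v\<in>V. z v * (\<Sum>u\<in>nb v. x u)) = (\<Sum>v\<in>V. x v * (\<Sum>u\<in>nb v. z u))"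
  proof -
    have nb_sum: "(\<Sum>u\<in>nb v. f u) = (\<Sum>u\<in>V. if E v u then f u else 0)" for v and f :: "'a \<Rightarrow> real"
      using fin EV2 by (subst sum.inter_filter[symmetric]) (auto intro!: sum.cong)
    have "(\<Sum>v\<in>V. z v * (\<Sum>u\<in>nb v. x u)) = (\<Sum>v\<in>V. \<Sum>u\<in>V. z v * (if E v u then x u else 0))"
      by (simp only: nb_sum sum_distrib_left)
    also have "\<dots> = (\<Sum>u\<in>V. \<Sum>v\<in>V. z v * (if E v u then x u else 0))" by (rule sum.swap)
    also have "\<dots> = (\<Sum>u\<in>V. \<Sum>v\<in>V. x u * (if E u v then z v else 0))"
      using E_sym by (intro sum.cong refl) auto
    also have "\<dots> = (\<Sum>u\<in>V. x u * (\<Sum>v\<in>nb u. z v))"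
      by (simp only: nb_sum sum_distrib_left)
    finally show ?thesis .
  qed
  \<comment> \<open>Pairing \<open>eig\<close> with \<open>z\<close> and moving \<open>Q(G)\<close>
    over to \<open>z\<close> by symmetry turns the eigenvalue inequality into an upper bound for the
    sum of \<open>x v * P v\<close>.\<close>
  have "q * (\<Sum>v\<in>V. z v * x v) = (\<Sum>v\<in>V. z v * (q * (d v * y v)))"
    by (simp add: sum_distrib_left x_def mult_ac)
  also have "\<dots> \<le> (\<Sum>v\<in>V. z v * ((d v)\<^sup>2 * y v + (\<Sum>u\<in>nb v. d u * y u)))"
    using z_pos eig by (intro sum_mono mult_left_mono) (auto intro: less_imp_le)
  also have "\<dots> = (\<Sum>v\<in>V. x v * (d v * z v)) + (\<Sum>v\<in>V. z v * (\<Sum>u\<in>nb v. x u))"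
    by (simp add: x_def sum.distrib distrib_left power2_eq_square mult_ac)
  also have "\<dots> = (\<Sum>v\<in>V. x v * (\<Sum>u\<in>nb v. z v + z u))"
    by (simp add: swap sum.distrib distrib_left card_nb)
  also have "\<dots> = ?\<mu> * (\<Sum>v\<in>V. z v * x v) - (\<Sum>v\<in>V. x v * P v)"
    by (simp add: P_def right_diff_distrib sum_subtractf sum_distrib_left mult_ac)
  finally have "(\<Sum>v\<in>V. x v * P v) \<le> (?\<mu> - q) * (\<Sum>v\<in>V. z v * x v)"
    by (simp add: algebra_simps)
  also have "\<dots> \<le> 0"
    using q_ge z_pos x_nonneg
    by (intro mult_nonpos_nonneg sum_nonneg mult_nonneg_nonneg) (auto intro: less_imp_le)
  finally have "(\<Sum>v\<in>V. x v * P v) = 0"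
    using x_nonneg P_nonneg by (intro antisym sum_nonneg mult_nonneg_nonneg) auto
  then have xP: "x v * P v = 0" if "v \<in> V" for v
    using sum_nonneg_eq_0_iff[OF fin, of "\<lambda>v. x v * P v"] x_nonneg P_nonneg that by simp

  \<comment> \<open>Vertices of \<open>L\<close> have positive \<open>x\<close>, so
    \<open>P v = 0\<close> on \<open>L0\<close>. There \<open>P v\<close> is a sum of positive terms
    over the missing neighbours, so none is missing.\<close>
  have full: "V - {v} = nb v" if v: "v \<in> L0" for v
  proof -
    have vL: "v \<in> L" "v \<in> V" using v L0 L0V by auto
    have "0 < y v" using y_L[OF vL(1)] by linarith
    moreover have "0 < d v" using vL(1) n_ge_k_nat k3 by (simp add: L_def)
    ultimately have "P v = 0" using xP[OF vL(2)] by (simp add: x_def)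
    then have "(\<Sum>u\<in>V - {v} - nb v. 1 + z u) = 0" using P_in[OF v] by simp
    moreover have pos: "0 < 1 + z u" for u using z_pos[of u] by simp
    ultimately have "\<forall>u\<in>V - {v} - nb v. 1 + z u = 0"
      using fin pos by (subst (asm) sum_nonneg_eq_0_iff) (auto intro: less_imp_le)
    then have "V - {v} - nb v = {}" using z_pos by (smt (verit) all_not_in_conv)
    then show ?thesis using nb_subset[of v] by auto
  qed
  have "E u v \<longleftrightarrow> u \<noteq> v \<and> (u \<in> L0 \<or> v \<in> L0)" if uv: "u \<in> V" "v \<in> V" for u v
  proof
    assume e: "E u v"
    have "u \<in> L0 \<or> v \<in> L0"
    proof (rule ccontr)
      assume n: "\<not> (u \<in> L0 \<or> v \<in> L0)"
      then have "u \<in> nb l1" using full[OF l1(1)] uv(1) l1(1) by auto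
      then show False using no_edge[of u v l1] n e l1 E_sym by auto
    qed
    then show "u \<noteq> v \<and> (u \<in> L0 \<or> v \<in> L0)" using e by auto
  next
    assume "u \<noteq> v \<and> (u \<in> L0 \<or> v \<in> L0)"
    then show "E u v" using full[of u] full[of v] uv E_sym by auto
  qed
  then show thesis using that L0V L0(3) by blast
qed

end

section \<open>Cycles and isomorphism with \<open>S\<^sub>n\<^sub>,\<^sub>k\<close>\<close>

text \<open>Translates vertex lists into arc lists. The endpoint \<open>z\<close> stays arbitrary
  for the induction; a cycle is the case \<open>z = hd c\<close>.\<close>

lemma walk_of_vertex_list:
  assumes "pair_graph G"
  shows "c \<noteq> [] \<Longrightarrow> successively (\<lambda>u v. (u, v) \<in> parcs G) c \<Longrightarrow> (last c, z) \<in> parcs G \<Longrightarrow>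
    \<exists>p. pre_digraph.awalk (with_proj G) (hd c) p z \<and>
      pre_digraph.awalk_verts (with_proj G) (hd c) p = c @ [z] \<and> length p = length c"
proof (induction c rule: induct_list012)
  case (2 u)
  interpret pair_graph G by fact
  show ?case
    using 2 in_arcsD1[of u z] by (intro exI[of _ "[(u, z)]"]) (auto simp: awalk_def pawalk_verts.simps)
next
  case (3 u v c)
  interpret pair_graph G by fact
  obtain p where p: "awalk v p z" "pawalk_verts v p = (v # c) @ [z]" "length p = length (v # c)"
    using 3 by auto
  have "(u, v) \<in> parcs G" using 3 by simp
  then show ?case
    using p in_arcsD1[of u v] by (intro exI[of _ "(u, v) # p"]) (auto simp: awalk_def)
qed simp

lemma contains_cycleI:
  assumes "pair_graph G" "distinct c" "successively (\<lambda>u v. (u, v) \<in> parcs G) c" "c \<noteq> []"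
    "(last c, hd c) \<in> parcs G"
  shows "contains_cycle G (length c)"
proof -
  interpret pair_graph G by fact
  obtain p where p: "awalk (hd c) p (hd c)" "pawalk_verts (hd c) p = c @ [hd c]" "length p = length c"
    using walk_of_vertex_list[OF assms(1,4,3,5)] by auto
  have "distinct (tl (c @ [hd c]))" using assms(2,4) by (cases c) auto
  then have "cycle p" using p assms(4) by (auto simp: cycle_def)
  then show ?thesis using p(3) by (auto simp: contains_cycle_def)
qed

lemma iso_S_graph:
  assumes "pair_graph G" "card (pverts G) = n" "L0 \<subseteq> pverts G" "card L0 = k"
    and adj: "\<And>u v. u \<in> pverts G \<Longrightarrow> v \<in> pverts G \<Longrightarrow>
      (u, v) \<in> parcs G \<longleftrightarrow> u \<noteq> v \<and> (u \<in> L0 \<or> v \<in> L0)"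
  shows "digraph_iso (with_proj G) (with_proj (S_graph n k))"
proof -
  interpret pair_graph G by fact
  have fin: "finite (pverts G)" by (rule pair_finite_verts)
  have fL: "finite L0" using assms(3) fin by (rule finite_subset)
  have kn: "k \<le> n" using card_mono[OF fin assms(3)] assms(2,4) by simp
  obtain f where f: "bij_betw f L0 {0..<k}"
    using ex_bij_betw_finite_nat[OF fL] assms(4) by auto
  have "card (pverts G - L0) = card {k..<n}"
    using card_Diff_subset[OF fL assms(3)] assms(2,4) by simp
  then obtain g where g: "bij_betw g (pverts G - L0) {k..<n}"
    using fin by (meson finite_Diff finite_atLeastLessThan finite_same_card_bij)
  define h where "h v = (if v \<in> L0 then f v else g v)" for v
  have hf: "bij_betw h L0 {0..<k}"
    using f by (subst bij_betw_cong[of _ h f]) (auto simp: h_def)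
  have hg: "bij_betw h (pverts G - L0) {k..<n}"
    using g by (subst bij_betw_cong[of _ h g]) (auto simp: h_def)
  have "bij_betw h (L0 \<union> (pverts G - L0)) ({0..<k} \<union> {k..<n})"
    by (intro bij_betw_combine hf hg) auto
  moreover have "L0 \<union> (pverts G - L0) = pverts G" "{0..<k} \<union> {k..<n} = {0..<n}"
    using assms(3) kn by auto
  ultimately have h: "bij_betw h (pverts G) {0..<n}" by simp
  have less: "h v < k \<longleftrightarrow> v \<in> L0" if "v \<in> pverts G" for v
    using bspec[OF bij_betwE[OF hf], of v] bspec[OF bij_betwE[OF hg], of v] that
    by (cases "v \<in> L0") auto
  have "(u, v) \<in> parcs G \<longleftrightarrow> (h u, h v) \<in> parcs (S_graph n k)"
    if uv: "u \<in> pverts G" "v \<in> pverts G" for u v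
    using adj[OF uv] less[OF uv(1)] less[OF uv(2)] bij_betwE[OF h] uv kn
      inj_on_eq_iff[OF bij_betw_imp_inj_on[OF h] uv]
    by (auto simp: parcs_S_graph)
  then show ?thesis
    using h kn unfolding digraph_iso_with_proj_iff[OF assms(1) pair_graph_S_graph[OF kn]]
    by (auto simp: pverts_S_graph)
qed

theorem theorem2:
  fixes n k :: nat and G :: "'a pair_pre_digraph"
  assumes "k \<ge> 3" and "n \<ge> 110 * k^2"
    and "pair_graph G" and "card (pverts G) = n"
    and "\<not> contains_cycle G (2 * k + 1)"
    and "\<not> digraph_iso (with_proj G) (with_proj (S_graph n k))"
  shows "Q_index G < Q_index (S_graph n k)"
proof (rule ccontr)
  assume contr: "\<not> ?thesis"
  interpret G: pair_graph G by fact
  define V where "V = pverts G"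
  define E where "E = (\<lambda>u v. (u, v) \<in> parcs G)"
  define q where "q = Q_index G"
  have kn: "k \<ge> 1" "n \<ge> 2 * k\<^sup>2" using assms(1,2) by auto
  have "k\<^sup>2 > 0" using assms(1) by simp
  then have n0: "n > 0" using assms(2) by linarith
  have q_ge: "S_mu n k \<le> q" using S_mu_le_Q_index[OF kn] contr by (simp add: q_def)
  then have q_pos: "q > 0" using S_mu_props(2)[OF kn] n0 by linarith
  interpret finite_graph V E
  proof
    show "finite V" unfolding V_def by (rule G.pair_finite_verts)
    show "symp E" using G.pair_sym_arcs by (auto simp: E_def symmetric_def sym_def symp_def)
    show "irreflp E" using G.pair_no_loops by (force simp: E_def irreflp_def)
    show "u \<in> V" if "E u v" for u v using that G.in_arcsD1 by (auto simp: E_def V_def)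
  qed
  have "pverts G \<noteq> {}" using assms(4) n0 by auto
  note eigenvalue = Q_index_eigenvalue[OF assms(3) this]
  have degree: "out_degree (with_proj G) v = d v" for v
    using card_nb[of v] by (simp add: out_degree_with_proj E_def)
  obtain x0 where x0: "\<exists>v\<in>V. x0 v \<noteq> 0"
    and ev: "\<And>v. v \<in> V \<Longrightarrow> real (d v) * x0 v + (\<Sum>u\<in>nb v. x0 u) = q * x0 v"
    using eigenvalue unfolding eigenvalue_signless_laplacian_iff[OF assms(3)] degree
    unfolding V_def E_def q_def by blast
  have isolated: "x0 v = 0" if "v \<in> V" "d v = 0" for v
  proof -
    have "nb v = {}" using that(2) card_nb[of v] by simp
    then show ?thesis using ev[OF that(1)] that(2) q_pos by simp
  qed
  \<comment> \<open>Division by zero yields 0, which is the right value at isolated vertices: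
    \<open>x0\<close> vanishes there, so \<open>d v * y0 v = \<bar>x0 v\<bar>\<close> holds
    throughout \<open>V\<close>.\<close>
  define y0 where "y0 v = \<bar>x0 v\<bar> / d v" for v
  define M where "M = Max (y0 ` V)"
  have Vne: "V \<noteq> {}" using x0 by auto
  have M_in: "M \<in> y0 ` V" unfolding M_def using fin Vne by (intro Max_in) auto
  then obtain w where w: "w \<in> V" "y0 w = M" by auto
  have y0_le: "y0 v \<le> M" if "v \<in> V" for v unfolding M_def using fin that by simp
  obtain v1 where v1: "v1 \<in> V" "x0 v1 \<noteq> 0" using x0 by blast
  then have "d v1 \<noteq> 0" using isolated by blast
  then have "0 < y0 v1" using v1 by (simp add: y0_def)
  then have M_pos: "0 < M" using y0_le[OF v1(1)] by linarith
  have dy0: "d v * y0 v = \<bar>x0 v\<bar>" if "v \<in> V" for v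
    using isolated[OF that] by (cases "d v = 0") (auto simp: y0_def)
  have "extremal_graph V E k n q (\<lambda>v. y0 v / M) w"
  proof
    show "3 \<le> k" "110 * k\<^sup>2 \<le> n" "card V = n" "S_mu n k \<le> q"
      using assms q_ge by (auto simp: V_def)
    show "length c \<noteq> 2 * k + 1"
      if "distinct c" "successively E c" "c \<noteq> []" "E (last c) (hd c)" for c
      using contains_cycleI[OF assms(3) that(1)] that assms(5) unfolding E_def by metis
    show "0 \<le> y0 v / M" for v using M_pos by (simp add: y0_def)
    show "y0 v / M \<le> 1" if "v \<in> V" for v using M_pos y0_le[OF that] by simp
    show "w \<in> V" "y0 w / M = 1" using w M_pos by auto
    show "0 < d w" using w(2) M_pos by (cases "d w = 0") (simp_all add: y0_def)
    show "q * (d v * (y0 v / M)) \<le> (d v)\<^sup>2 * (y0 v / M) + (\<Sum>u\<in>nb v. d u * (y0 u / M))"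
      if v: "v \<in> V" for v
    proof -
      \<comment> \<open>The triangle inequality in the eigenvalue equation; \<open>q > 0\<close>
        lets the absolute value pass \<open>q\<close>.\<close>
      have "q * \<bar>x0 v\<bar> = \<bar>real (d v) * x0 v + (\<Sum>u\<in>nb v. x0 u)\<bar>"
        using ev[OF v] q_pos by (simp add: abs_mult)
      also have "\<dots> \<le> d v * \<bar>x0 v\<bar> + (\<Sum>u\<in>nb v. \<bar>x0 u\<bar>)"
        using abs_triangle_ineq[of "real (d v) * x0 v" "\<Sum>u\<in>nb v. x0 u"] sum_abs[of x0 "nb v"]
          abs_mult[of "real (d v)" "x0 v"]
        by linarith
      also have "(\<Sum>u\<in>nb v. \<bar>x0 u\<bar>) = (\<Sum>u\<in>nb v. d u * y0 u)"
        using EV2 by (intro sum.cong refl dy0[symmetric]) auto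
      finally have "q * (d v * y0 v) \<le> (d v)\<^sup>2 * y0 v + (\<Sum>u\<in>nb v. d u * y0 u)"
        by (simp add: dy0[OF v, symmetric] power2_eq_square mult.assoc)
      from divide_right_mono[OF this less_imp_le[OF M_pos]] show ?thesis
        by (simp add: add_divide_distrib sum_divide_distrib)
    qed
  qed
  then obtain L0 where "L0 \<subseteq> V" "card L0 = k"
    "\<And>u v. u \<in> V \<Longrightarrow> v \<in> V \<Longrightarrow> E u v \<longleftrightarrow> u \<noteq> v \<and> (u \<in> L0 \<or> v \<in> L0)"
    by (metis extremal_graph.extremal_structure)
  then show False
    using iso_S_graph[OF assms(3,4)] assms(6) unfolding V_def E_def by blast
qed

end
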